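(* Consider a two-armed Bernoulli bandit with means $0<\mu_2<\mu_1<1$. For $\pi=\mathrm{TS}$ (Thompson Sampling with uniform priors) or $\pi=\mathrm{MED}$, and every integer $T\ge1$, $$\mathrm{RegExp}(\pi;T)=\mu_1-\mu_2 .$$
   Context: Two-armed Bernoulli bandit: at each time $t\ge1$ the policy picks an arm $A_t\in\{1,2\}$ (possibly with internal randomization) from the history $(A_1,R_1,\dots,A_{t-1},R_{t-1})$, then observes $R_t\in\{0,1\}$ which, given $A_t$, is Bernoulli with mean $\mu_{A_t}$, independent of the past and of the policy's internal randomness. $N_a(t):=\sum_{i=1}^{t-1}\mathbf 1(A_i=a)$, $S_a(t):=\sum_{i=1}^{t-1}\mathbf 1(A_i=a)R_i$, $\hat\mu_a(t):=S_a(t)/N_a(t)$, $\hat\mu^*(t):=\max_a\hat\mu_a(t)$; $\mathrm{kl}(p,q):=p\log\frac pq+(1-p)\log\frac{1-p}{1-q}\in[0,\infty]$. Thompson Sampling (TS): at time $t$, sample (independently across arms given the history) $\theta_a(t)\sim\mathrm{Beta}(1+S_a(t),1+N_a(t)-S_a(t))$ and pull $A_t\in\arg\max_a\theta_a(t)$. MED: each arm is pulled once initially; afterwards, at time $t$, arm $a$ is sampled with probability proportional to $\exp(-N_a(t)\,\mathrm{kl}(\hat\mu_a(t),\hat\mu^*(t)))$, with $\exp(-\infty)=0$. $\mathrm{Reg}(s;s+T):=\sum_{i=0}^{T-1}(\mu_1-\mu_{A_{s+i}})$. Exploration episodes: $\tau_1:=\inf\{t:A_t=2\}$, $\tau_{k+1}:=\inf\{t>\tau_k:A_t=2,\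 A_{t-1}=1\}$. Regret of exploration: $\mathrm{RegExp}(T):=\limsup_{k\to\infty}\mathbb E[\mathrm{Reg}(\tau_k;\tau_k+T)]$. *)

theory Defs
  imports "HOL-Probability.Probability"
begin

datatype arm = Arm1 | Arm2

text \<open>Histories are in chronological order; the flag of an entry is the reward, \<open>True\<close> being 1.\<close>

type_synonym history = "(arm \<times> bool) list"

text \<open>If \<open>h\<close> is the history before time \<open>t\<close>, then \<open>pulls a h\<close>, \<open>successes a h\<close> and
  \<open>emp_mean a h\<close> are the statistics N, S and mu-hat of arm \<open>a\<close> at time \<open>t\<close>.\<close>

definition pulls :: "arm \<Rightarrow> history \<Rightarrow> nat" where
  "pulls a h = (\<Sum>(b, r)\<leftarrow>h. of_bool (b = a))"

definition successes :: "arm \<Rightarrow> history \<Rightarrow> nat" where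
  "successes a h = (\<Sum>(b, r)\<leftarrow>h. of_bool (b = a) * of_bool r)"

definition emp_mean :: "arm \<Rightarrow> history \<Rightarrow> real" where
  "emp_mean a h = real (successes a h) / real (pulls a h)"

definition best_emp_mean :: "history \<Rightarrow> real" where
  "best_emp_mean h = max (emp_mean Arm1 h) (emp_mean Arm2 h)"

text \<open>A policy maps the history to the conditional distribution of the next arm; the internal
  randomization of the policy is integrated out.\<close>

type_synonym policy = "history \<Rightarrow> arm pmf"

text \<open>Times start at 1; the values of \<open>A\<close> and \<open>R\<close> at time 0 play no role.\<close>

definition history_before :: "(nat \<Rightarrow> 'w \<Rightarrow> arm) \<Rightarrow> (nat \<Rightarrow> 'w \<Rightarrow> bool) \<Rightarrow> nat \<Rightarrow> 'w \<Rightarrow> history" where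
  "history_before A R t \<omega> = map (\<lambda>i. (A i \<omega>, R i \<omega>)) [1..<t]"

text \<open>The last two assumptions say, in product form, that given the history \<open>h\<close> the arm has
  distribution \<open>\<pi> h\<close>, and that given the history and the arm \<open>a\<close> the reward is Bernoulli with
  mean \<open>\<mu> a\<close>. Histories are discrete, so this fixes the joint law of \<open>A\<close> and \<open>R\<close> at
  positive times.\<close>

locale bandit_process = prob_space M
  for M :: "'w measure" +
  fixes \<mu> :: "arm \<Rightarrow> real"
    and \<pi> :: policy
    and A :: "nat \<Rightarrow> 'w \<Rightarrow> arm"
    and R :: "nat \<Rightarrow> 'w \<Rightarrow> bool"
  assumes measurable_arm: "t \<ge> 1 \<Longrightarrow> A t \<in> measurable M (count_space UNIV)"
    and measurable_reward: "t \<ge> 1 \<Longrightarrow> R t \<in> measurable M (count_space UNIV)"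
    and arm_law: "t \<ge> 1 \<Longrightarrow>
      \<P>(\<omega> in M. history_before A R t \<omega> = h \<and> A t \<omega> = a)
        = \<P>(\<omega> in M. history_before A R t \<omega> = h) * pmf (\<pi> h) a"
    and reward_law: "t \<ge> 1 \<Longrightarrow>
      \<P>(\<omega> in M. history_before A R t \<omega> = h \<and> A t \<omega> = a \<and> R t \<omega> = r)
        = \<P>(\<omega> in M. history_before A R t \<omega> = h \<and> A t \<omega> = a) * pmf (bernoulli_pmf (\<mu> a)) r"

definition beta_density :: "real \<Rightarrow> real \<Rightarrow> real \<Rightarrow> real" where
  "beta_density \<alpha> \<beta> x =
    (if 0 < x \<and> x < 1 then x powr (\<alpha> - 1) * (1 - x) powr (\<beta> - 1) / Beta \<alpha> \<beta> else 0)"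

definition beta_measure :: "real \<Rightarrow> real \<Rightarrow> real measure" where
  "beta_measure \<alpha> \<beta> = density lborel (\<lambda>x. ennreal (beta_density \<alpha> \<beta> x))"

definition posterior :: "history \<Rightarrow> (arm \<Rightarrow> real) measure" where
  "posterior h = (\<Pi>\<^sub>M a\<in>UNIV.
     beta_measure (1 + real (successes a h)) (1 + real (pulls a h) - real (successes a h)))"

text \<open>\<open>sel\<close> is the rule by which an arm in the argmax of the sampled \<open>\<theta>\<close> is picked; any
  measurable tie-breaking is allowed.\<close>

definition thompson_sampling :: "policy \<Rightarrow> bool" where
  "thompson_sampling \<pi> \<longleftrightarrow> (\<forall>h. \<exists>sel.
     sel \<in> measurable (\<Pi>\<^sub>M a\<in>(UNIV :: arm set). (borel :: real measure)) (count_space UNIV) \<and>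
     (\<forall>\<theta>. is_arg_max \<theta> (\<lambda>_. True) (sel \<theta>)) \<and>
     measure_pmf (\<pi> h) = distr (posterior h) (count_space UNIV) sel)"

text \<open>\<open>xlog p q\<close> is \<open>p log (p/q)\<close> with the conventions \<open>0 log (0/q) = 0\<close> and
  \<open>p log (p/0) = \<infinity>\<close> for \<open>p > 0\<close>.\<close>

definition xlog :: "real \<Rightarrow> real \<Rightarrow> ereal" where
  "xlog p q = (if p = 0 then 0 else if q = 0 then \<infinity> else ereal (p * ln (p / q)))"

definition kl :: "real \<Rightarrow> real \<Rightarrow> ereal" where
  "kl p q = xlog p q + xlog (1 - p) (1 - q)"

definition exp_minus :: "ereal \<Rightarrow> real" where
  "exp_minus x = (if x = \<infinity> then 0 else exp (- real_of_ereal x))"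

definition med_weight :: "history \<Rightarrow> arm \<Rightarrow> real" where
  "med_weight h a = exp_minus (ereal (real (pulls a h)) * kl (emp_mean a h) (best_emp_mean h))"

text \<open>The order of the two initial pulls is left open: as long as some arm has not been pulled,
  an unpulled arm is played.\<close>

definition med :: "policy \<Rightarrow> bool" where
  "med \<pi> \<longleftrightarrow> (\<forall>h.
     if \<exists>a. pulls a h = 0 then set_pmf (\<pi> h) \<subseteq> {a. pulls a h = 0}
     else \<forall>a. pmf (\<pi> h) a = med_weight h a / (\<Sum>b\<in>UNIV. med_weight h b))"

definition regret :: "(arm \<Rightarrow> real) \<Rightarrow> (nat \<Rightarrow> arm) \<Rightarrow> nat \<Rightarrow> nat \<Rightarrow> real" where
  "regret \<mu> \<alpha> s T = (\<Sum>i<T. \<mu> Arm1 - \<mu> (\<alpha> (s + i)))"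

text \<open>\<open>episode_start \<alpha> k\<close> is the start of exploration episode number \<open>k + 1\<close> along the path of
  arms \<open>\<alpha>\<close>; it is \<open>\<infinity>\<close>, the infimum of the empty set, if there is no such episode.\<close>

primrec episode_start :: "(nat \<Rightarrow> arm) \<Rightarrow> nat \<Rightarrow> enat" where
  "episode_start \<alpha> 0 = Inf (enat ` {t. 1 \<le> t \<and> \<alpha> t = Arm2})"
| "episode_start \<alpha> (Suc k) =
     Inf (enat ` {t. episode_start \<alpha> k < enat t \<and> \<alpha> t = Arm2 \<and> \<alpha> (t - 1) = Arm1})"

text \<open>The regret of an episode that never starts is set to 0.\<close>

definition episode_regret :: "(arm \<Rightarrow> real) \<Rightarrow> (nat \<Rightarrow> arm) \<Rightarrow> nat \<Rightarrow> nat \<Rightarrow> real" where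
  "episode_regret \<mu> \<alpha> k T =
     (case episode_start \<alpha> k of enat s \<Rightarrow> regret \<mu> \<alpha> s T | \<infinity> \<Rightarrow> 0)"

definition RegExp :: "'w measure \<Rightarrow> (arm \<Rightarrow> real) \<Rightarrow> (nat \<Rightarrow> 'w \<Rightarrow> arm) \<Rightarrow> nat \<Rightarrow> ereal" where
  "RegExp M \<mu> A T =
     limsup (\<lambda>k. ereal (\<integral>\<omega>. episode_regret \<mu> (\<lambda>t. A t \<omega>) k T \<partial>M))"

end

theory Submission
  imports Defs
begin

text \<open>Only qualitative facts are needed. Ville's inequality for Hoeffding's exponential
  supermartingale and Borel--Cantelli give that the empirical mean of an arm converges to its true
  mean along every path on which the arm is pulled infinitely often. If an arm were pulled only
  finitely often, its statistics would freeze while the empirical mean of the other arm converges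
  to a number below 1; under both policies its conditional probability of being pulled would then
  stay bounded below, and a conditional Borel--Cantelli argument rules this out. So both arms are
  pulled infinitely often, all episodes start, and the conditional probability of pulling the
  second arm tends to 0, since for TS the posteriors concentrate at separated points and for MED
  the exponent tends to infinity. Conditioning on the start of an episode, which is a stopping
  time, the expected number of further pulls of the second arm among the next T - 1 rounds tends
  to 0 by dominated convergence, so only the first pull contributes regret in the limit.\<close>

subsection \<open>The Beta distribution\<close>

text \<open>The rewards of one arm do not come as an independent sequence, because the times of its
  pulls depend on the past. Rather than rebuilding such a sequence, the deviation bound uses a
  supermartingale whose clock is the number of pulls of the arm: it stands still while the other arm
  is played, and one maximal inequality covers all times with the same count. The process is
  specified only through products of probabilities of finite histories, so conditional expectations
  become finite sums over histories, and events to be conditioned on are written as predicates of a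
  history and its prefixes. A frozen arm would keep being tried because its competitor settles below
  1: a posterior with fixed parameters still charges every neighbourhood of 1, and a MED weight with
  fixed pull count can degenerate only when the best empirical mean approaches 1. No rates are
  required at the end: the start with index \<open>k\<close> lies beyond time \<open>k\<close>, so
  limits in time pass directly to limits in the episode number.\<close>

lemma Beta_pos_real:
  fixes a b :: real
  assumes "a > 0" "b > 0"
  shows "Beta a b > 0"
  using assms by (auto simp: Beta_def intro!: mult_pos_pos divide_pos_pos Gamma_real_pos)

lemma beta_density_nonneg:
  assumes "a > 0" "b > 0"
  shows "beta_density a b x \<ge> 0"
  using Beta_pos_real[OF assms] by (simp add: beta_density_def)

lemma beta_density_measurable [measurable]: "beta_density a b \<in> borel_measurable borel"
  unfolding beta_density_def by measurable

lemma sets_beta_measure [simp, measurable_cong]: "sets (beta_measure a b) = sets borel"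
  by (simp add: beta_measure_def)

lemma space_beta_measure [simp]: "space (beta_measure a b) = UNIV"
  by (simp add: beta_measure_def)

text \<open>Weighting by \<open>x powr c\<close> shifts the first parameter of the Beta integral, so
  total mass, mean and second moment come from one computation. At \<open>c = 0\<close> the value
  \<open>0 powr 0 = 0\<close> is harmless because the density vanishes at 0.\<close>

lemma has_integral_beta_density_moment:
  fixes a b c :: real
  assumes "a > 0" "b > 0" "c \<ge> 0"
  shows "((\<lambda>x. x powr c * beta_density a b x) has_integral (Beta (a + c) b / Beta a b)) UNIV"
proof -
  have "((\<lambda>x. x powr (a + c - 1) * (1 - x) powr (b - 1)) has_integral Beta (a + c) b) {0<..<1}"
    using has_integral_Beta_real[of "a + c" b] assms by (simp add: has_integral_Icc_iff_Ioo)
  then have "((\<lambda>x. x powr (a + c - 1) * (1 - x) powr (b - 1) * (1 / Beta a b)) has_integral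
      Beta (a + c) b * (1 / Beta a b)) {0<..<1}"
    by (rule has_integral_mult_left)
  then have "((\<lambda>x. x powr c * beta_density a b x) has_integral
      Beta (a + c) b * (1 / Beta a b)) {0<..<1}"
    by (rule has_integral_eq[rotated])
       (auto simp: beta_density_def powr_add powr_diff divide_simps)
  then have "((\<lambda>x. if x \<in> {0<..<1} then x powr c * beta_density a b x else 0) has_integral
      Beta (a + c) b * (1 / Beta a b)) UNIV"
    by (simp only: has_integral_restrict_UNIV)
  moreover have "(\<lambda>x. if x \<in> {0<..<1} then x powr c * beta_density a b x else 0) =
      (\<lambda>x. x powr c * beta_density a b x)"
    by (auto simp: beta_density_def fun_eq_iff)
  ultimately show ?thesis by simp
qed

lemma beta_moments:
  fixes a b :: real
  assumes "a > 0" "b > 0"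
  shows "Beta (a + 1) b / Beta a b = a / (a + b)"
    and "Beta (a + 2) b / Beta a b = a * (a + 1) / ((a + b) * (a + b + 1))"
proof -
  have "(a + b) * Beta (a + 1) b = a * Beta a b"
    using assms by (intro Beta_plus1_left) auto
  then have 1: "Beta (a + 1) b = a * Beta a b / (a + b)"
    using assms by (simp add: nonzero_eq_divide_eq mult.commute)
  have "(a + 1 + b) * Beta (a + 1 + 1) b = (a + 1) * Beta (a + 1) b"
    using assms by (intro Beta_plus1_left) auto
  then have 2: "Beta (a + 2) b = (a + 1) * Beta (a + 1) b / (a + b + 1)"
    using assms by (simp add: nonzero_eq_divide_eq ac_simps)
  show "Beta (a + 1) b / Beta a b = a / (a + b)"
    and "Beta (a + 2) b / Beta a b = a * (a + 1) / ((a + b) * (a + b + 1))"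
    using Beta_pos_real[OF assms] assms by (auto simp: 2 1)
qed

text \<open>The centre \<open>m\<close> is arbitrary rather than the mean: it will be the limit of
  the empirical means, while the posterior mean keeps moving. The value thus contains squared bias
  as well as variance.\<close>

lemma has_integral_beta_density_square:
  fixes a b m :: real
  assumes "a > 0" "b > 0"
  shows "((\<lambda>x. (x - m)\<^sup>2 * beta_density a b x) has_integral
     (a * (a + 1) / ((a + b) * (a + b + 1)) - 2 * m * (a / (a + b)) + m\<^sup>2)) UNIV"
proof -
  have i0: "((\<lambda>x. x powr 0 * beta_density a b x) has_integral 1) UNIV"
    using has_integral_beta_density_moment[OF assms, of 0] Beta_pos_real[OF assms] by simp
  have i1: "((\<lambda>x. x powr 1 * beta_density a b x) has_integral (a / (a + b))) UNIV"
    using has_integral_beta_density_moment[OF assms, of 1] beta_moments[OF assms] by simp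
  have i2: "((\<lambda>x. x powr 2 * beta_density a b x) has_integral
      (a * (a + 1) / ((a + b) * (a + b + 1)))) UNIV"
    using has_integral_beta_density_moment[OF assms, of 2] beta_moments[OF assms] by simp
  have "((\<lambda>x. x powr 2 * beta_density a b x - 2 * m * (x powr 1 * beta_density a b x)
      + m\<^sup>2 * (x powr 0 * beta_density a b x)) has_integral
     (a * (a + 1) / ((a + b) * (a + b + 1)) - 2 * m * (a / (a + b)) + m\<^sup>2 * 1)) UNIV"
    by (intro has_integral_add has_integral_diff has_integral_mult_right i0 i1 i2)
  then have "((\<lambda>x. (x - m)\<^sup>2 * beta_density a b x) has_integral
     (a * (a + 1) / ((a + b) * (a + b + 1)) - 2 * m * (a / (a + b)) + m\<^sup>2 * 1)) UNIV"
    by (rule has_integral_eq[rotated])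
       (auto simp: beta_density_def power2_eq_square algebra_simps)
  then show ?thesis by simp
qed

lemma prob_space_beta_measure:
  assumes "a > 0" "b > 0"
  shows "prob_space (beta_measure a b)"
proof
  have "((\<lambda>x. beta_density a b x) has_integral 1) UNIV"
  proof (rule has_integral_eq[rotated])
    show "((\<lambda>x. x powr 0 * beta_density a b x) has_integral 1) UNIV"
      using has_integral_beta_density_moment[OF assms, of 0] Beta_pos_real[OF assms] by simp
  qed (auto simp: beta_density_def)
  then have "(\<integral>\<^sup>+x. beta_density a b x \<partial>lborel) = 1"
    using nn_integral_has_integral_lborel[of "beta_density a b" 1] beta_density_nonneg[OF assms]
    by simp
  then show "emeasure (beta_measure a b) (space (beta_measure a b)) = 1"
    by (simp add: beta_measure_def emeasure_density)
qed

lemma beta_measure_Chebyshev: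
  assumes "a > 0" "b > 0" "\<epsilon> > 0"
  shows "measure (beta_measure a b) {x. \<epsilon> \<le> \<bar>x - m\<bar>} \<le>
    (a * (a + 1) / ((a + b) * (a + b + 1)) - 2 * m * (a / (a + b)) + m\<^sup>2) / \<epsilon>\<^sup>2"
    (is "_ \<le> ?V / _")
proof -
  interpret prob_space "beta_measure a b" by (rule prob_space_beta_measure) fact+
  have dens: "beta_density a b x \<ge> 0" for x by (rule beta_density_nonneg) fact+
  have int: "((\<lambda>x. (x - m)\<^sup>2 * beta_density a b x) has_integral ?V) UNIV"
    by (rule has_integral_beta_density_square) fact+
  have V: "?V \<ge> 0" by (rule has_integral_nonneg[OF int]) (simp add: dens)
  have "ennreal (\<epsilon>\<^sup>2) * emeasure (beta_measure a b) {x. \<epsilon> \<le> \<bar>x - m\<bar>} =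
      (\<integral>\<^sup>+x. ennreal (\<epsilon>\<^sup>2) * (ennreal (beta_density a b x) * indicator {x. \<epsilon> \<le> \<bar>x - m\<bar>} x) \<partial>lborel)"
    by (subst nn_integral_cmult) (auto simp: beta_measure_def emeasure_density)
  also have "\<dots> \<le> (\<integral>\<^sup>+x. (x - m)\<^sup>2 * beta_density a b x \<partial>lborel)"
  proof (rule nn_integral_mono)
    fix x
    have "\<epsilon>\<^sup>2 \<le> (x - m)\<^sup>2" if "\<epsilon> \<le> \<bar>x - m\<bar>"
      using power_mono[OF that, of 2] assms by simp
    then show "ennreal (\<epsilon>\<^sup>2) * (ennreal (beta_density a b x) * indicator {x. \<epsilon> \<le> \<bar>x - m\<bar>} x) \<le>
        ennreal ((x - m)\<^sup>2 * beta_density a b x)"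
      using dens[of x]
      by (auto simp: indicator_def ennreal_mult[symmetric] intro!: ennreal_leI mult_right_mono)
  qed
  also have "\<dots> = ennreal ?V"
    using int dens by (intro nn_integral_has_integral_lborel) auto
  finally have "\<epsilon>\<^sup>2 * measure (beta_measure a b) {x. \<epsilon> \<le> \<bar>x - m\<bar>} \<le> ?V"
    using V by (simp add: emeasure_eq_measure ennreal_mult[symmetric])
  then show ?thesis using assms by (simp add: pos_le_divide_eq mult.commute)
qed

text \<open>The density is strictly positive on the open unit interval, so mass zero would make a
  nonempty open interval Lebesgue null. Supplies the chance that a frozen posterior exceeds a level
  below 1.\<close>

lemma beta_measure_atLeast_pos:
  assumes "a > 0" "b > 0" "x < 1"
  shows "measure (beta_measure a b) {x..} > 0"
proof (rule ccontr)
  interpret prob_space "beta_measure a b" by (rule prob_space_beta_measure) fact+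
  assume "\<not> ?thesis"
  then have "emeasure (beta_measure a b) {x..} = 0"
    by (simp add: emeasure_eq_measure zero_less_measure_iff)
  then have "AE y in lborel. ennreal (beta_density a b y) * indicator {x..} y = 0"
    unfolding beta_measure_def
    by (subst (asm) emeasure_density) (auto simp: nn_integral_0_iff_AE)
  then have "AE y in lborel. y \<notin> {max x 0<..<1::real}"
    by eventually_elim
       (use Beta_pos_real[OF assms(1,2)] in \<open>auto simp: beta_density_def indicator_def
           ennreal_eq_0_iff
        divide_le_0_iff mult_le_0_iff split: if_splits\<close>)
  then have "emeasure lborel {max x 0<..<1::real} = 0"
    by (intro null_setsD1) (simp add: AE_iff_null_sets)
  then show False using assms by simp
qed

subsection \<open>Exploration by the two policies\<close>

lemma UNIV_arm: "UNIV = {Arm1, Arm2}"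
  using arm.exhaust by auto

instance arm :: finite
  by standard (simp add: UNIV_arm)

lemma pulls_Nil [simp]: "pulls a [] = 0"
  by (simp add: pulls_def)

lemma successes_Nil [simp]: "successes a [] = 0"
  by (simp add: successes_def)

lemma pulls_snoc [simp]: "pulls a (h @ [(b, r)]) = pulls a h + of_bool (b = a)"
  by (simp add: pulls_def)

lemma successes_snoc [simp]:
  "successes a (h @ [(b, r)]) = successes a h + of_bool (b = a) * of_bool r"
  by (simp add: successes_def)

lemma successes_le_pulls: "successes a h \<le> pulls a h"
  by (induction h rule: rev_induct) (auto simp: of_bool_def)

lemma emp_mean_bounds: "0 \<le> emp_mean a h" "emp_mean a h \<le> 1"
  using successes_le_pulls[of a h] by (auto simp: emp_mean_def divide_le_eq_1)

section \<open>Thompson Sampling: concentration of the posterior and choice of the arm\<close>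

abbreviation posterior_marginal :: "history \<Rightarrow> arm \<Rightarrow> real measure" where
  "posterior_marginal h a \<equiv>
     beta_measure (1 + real (successes a h)) (1 + real (pulls a h) - real (successes a h))"

lemma prob_space_posterior_marginal: "prob_space (posterior_marginal h a)"
  using successes_le_pulls[of a h] by (intro prob_space_beta_measure) auto

text \<open>By independence the product is the probability that the sample of \<open>b\<close> is at
  least \<open>x\<close> and that of \<open>c\<close> is below \<open>x\<close>; then
  \<open>b\<close> is the unique maximiser, whatever the tie-breaking. The level \<open>x\<close>
  stays free: it separates the two true means in one use and lies between the mean of
  \<open>c\<close> and 1 in the other.\<close>

lemma thompson_sampling_ge:
  assumes TS: "thompson_sampling \<pi>" and "b \<noteq> c"
  shows "pmf (\<pi> h) b \<ge>
     measure (posterior_marginal h b) {x..} * measure (posterior_marginal h c) {..<x}"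
proof -
  interpret product_prob_space "posterior_marginal h" UNIV
    by (intro product_prob_spaceI prob_space_posterior_marginal)
  obtain sel where sel:
    "sel \<in> measurable (\<Pi>\<^sub>M a\<in>(UNIV :: arm set). (borel :: real measure)) (count_space UNIV)"
    "\<And>\<theta>. is_arg_max \<theta> (\<lambda>_. True) (sel \<theta>)"
    "measure_pmf (\<pi> h) = distr (posterior h) (count_space UNIV) sel"
    using TS unfolding thompson_sampling_def by blast
  have sets: "sets (posterior h) = sets (\<Pi>\<^sub>M a\<in>(UNIV :: arm set). (borel :: real measure))"
    unfolding posterior_def by (intro sets_PiM_cong) auto
  have sel': "sel \<in> measurable (posterior h) (count_space UNIV)"
    using sel(1) measurable_cong_sets[OF sets refl] by blast
  define E where "E = (\<lambda>a. if a = b then {x..} else {..<x})"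
  have "{b, c} = UNIV"
    using \<open>b \<noteq> c\<close> by (cases b; cases c) (auto simp: UNIV_arm)
  then have "emeasure (posterior h) (Pi\<^sub>E UNIV E) = (\<Prod>a\<in>{b,
      c}. emeasure (posterior_marginal h a) (E a))"
    unfolding posterior_def by (subst emeasure_PiM) (auto simp: E_def)
  also have "\<dots> = emeasure (posterior_marginal h b) {x..} * emeasure (posterior_marginal h c) {..<x}"
    using \<open>b \<noteq> c\<close> by (simp add: E_def)
  also have "\<dots> = ennreal (measure (posterior_marginal h b) {x..} * measure (posterior_marginal h
      c) {..<x})"
    by (simp add: M.emeasure_eq_measure ennreal_mult)
  finally have E: "emeasure (posterior h) (Pi\<^sub>E UNIV E) = \<dots>" .
  have "Pi\<^sub>E UNIV E \<subseteq> sel -` {b} \<inter> space (posterior h)"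
  proof
    fix \<theta> assume "\<theta> \<in> Pi\<^sub>E UNIV E"
    then have "\<theta> b \<in> E b" "\<theta> c \<in> E c" by auto
    then have "\<theta> c < \<theta> b" using \<open>b \<noteq> c\<close> by (auto simp: E_def)
    moreover have "\<not> \<theta> b > \<theta> (sel \<theta>)" using sel(2)[of \<theta>] by (auto simp: is_arg_max_def)
    ultimately have "sel \<theta> \<noteq> c" by auto
    then have "sel \<theta> = b" using \<open>{b, c} = UNIV\<close> by auto
    then show "\<theta> \<in> sel -` {b} \<inter> space (posterior h)"
      by (simp add: posterior_def space_PiM)
  qed
  then have "emeasure (posterior h) (Pi\<^sub>E UNIV E) \<le> emeasure (posterior h) (sel -` {b} \<inter> space
      (posterior h))"
    using sel' by (intro emeasure_mono measurable_sets) auto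
  also have "\<dots> = emeasure (measure_pmf (\<pi> h)) {b}"
    using sel' by (simp add: sel(3) emeasure_distr)
  also have "\<dots> = ennreal (pmf (\<pi> h) b)"
    by (simp add: emeasure_pmf_single)
  finally show ?thesis unfolding E by simp
qed

lemma posterior_marginal_concentrates:
  assumes pulls: "filterlim (\<lambda>t. pulls a (h t)) at_top F"
    and mean: "((\<lambda>t. emp_mean a (h t)) \<longlongrightarrow> m) F"
    and "\<epsilon> > 0"
  shows "((\<lambda>t. measure (posterior_marginal (h t) a) {x. \<epsilon> \<le> \<bar>x - m\<bar>}) \<longlongrightarrow> 0) F"
proof -
  define N where "N = (\<lambda>t. real (pulls a (h t)))"
  define p where "p = (\<lambda>t. emp_mean a (h t))"
  \<comment> \<open>The second moment about \<open>m\<close> of the posterior, with numerators and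
    denominators divided by the number \<open>n\<close> of pulls and \<open>q\<close> for the
    empirical mean. In this form the limit follows by continuity:
    \<open>m^2 - 2 * m^2 + m^2 = 0\<close>.\<close>
  define V where "V = (\<lambda>n q :: real. (1 / n + q) * (2 / n + q) / ((2 / n + 1) * (3 / n + 1))
    - 2 * m * ((1 / n + q) / (2 / n + 1)) + m\<^sup>2)"
  have N: "filterlim N at_top F"
    unfolding N_def by (rule filterlim_compose[OF filterlim_real_sequentially pulls])
  have lim: "((\<lambda>t. c / N t) \<longlongrightarrow> 0) F" for c
    by (rule real_tendsto_divide_at_top[OF tendsto_const N])
  have "((\<lambda>t. V (N t) (p t) / \<epsilon>\<^sup>2) \<longlongrightarrow>
     ((0 + m) * (0 + m) / ((0 + 1) * (0 + 1)) - 2 * m * ((0 + m) / (0 + 1)) + m\<^sup>2) / \<epsilon>\<^sup>2) F"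
    unfolding V_def p_def using \<open>\<epsilon> > 0\<close> by (intro tendsto_intros lim mean) auto
  then have *: "((\<lambda>t. V (N t) (p t) / \<epsilon>\<^sup>2) \<longlongrightarrow> 0) F"
    by (simp add: power2_eq_square)
  have "eventually (\<lambda>t. N t > 0) F"
    using N by (simp add: filterlim_at_top_dense)
  then have "eventually (\<lambda>t. measure (posterior_marginal (h t) a) {x. \<epsilon> \<le> \<bar>x - m\<bar>}
      \<le> V (N t) (p t) / \<epsilon>\<^sup>2) F"
  proof eventually_elim
    case (elim t)
    define s where "s = real (successes a (h t))"
    define n where "n = N t"
    have n: "n > 0" and s: "0 \<le> s" "s \<le> n"
      using elim successes_le_pulls[of a "h t"] by (auto simp: n_def s_def N_def)
    have pt: "p t = s / n" by (simp add: p_def emp_mean_def n_def s_def N_def)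
    have e: "1 / n + s / n = (1 + s) / n" "2 / n + s / n = (2 + s) / n" "2 / n + 1 = (2 + n) / n"
      "3 / n + 1 = (3 + n) / n"
      using n by (auto simp: field_simps)
    have "V n (p t) = (1 + s) * (2 + s) / ((2 + n) * (3 + n)) - 2 * m * ((1 + s) / (2 + n)) + m\<^sup>2"
      unfolding V_def pt e using n by simp
    moreover have "measure (posterior_marginal (h t) a) {x. \<epsilon> \<le> \<bar>x - m\<bar>} \<le>
      ((1 + s) * (1 + s + 1) / ((1 + s + (1 + n - s)) * (1 + s + (1 + n - s) + 1))
        - 2 * m * ((1 + s) / (1 + s + (1 + n - s))) + m\<^sup>2) / \<epsilon>\<^sup>2"
      unfolding s_def n_def N_def using successes_le_pulls[of a "h t"]
      by (intro beta_measure_Chebyshev \<open>\<epsilon> > 0\<close>) auto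
    ultimately show ?case by (simp add: n_def add.assoc add.commute)
  qed
  then show ?thesis
    by (rule tendsto_sandwich[OF _ _ tendsto_const *, rotated]) auto
qed

lemma posterior_marginal_tendsto_1:
  assumes "filterlim (\<lambda>t. pulls a (h t)) at_top F"
    and "((\<lambda>t. emp_mean a (h t)) \<longlongrightarrow> m) F"
    and "\<epsilon> > 0" and B: "B \<in> sets borel" "{x. \<bar>x - m\<bar> < \<epsilon>} \<subseteq> B"
  shows "((\<lambda>t. measure (posterior_marginal (h t) a) B) \<longlongrightarrow> 1) F"
proof (rule tendsto_sandwich)
  show "((\<lambda>t. 1 - measure (posterior_marginal (h t) a) {x. \<epsilon> \<le> \<bar>x - m\<bar>}) \<longlongrightarrow> 1) F"
    using tendsto_diff[OF tendsto_const[of 1] posterior_marginal_concentrates[OF assms(1-3)]]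
        by simp
  show "eventually (\<lambda>t. 1 - measure (posterior_marginal (h t) a) {x. \<epsilon> \<le> \<bar>x - m\<bar>}
     \<le> measure (posterior_marginal (h t) a) B) F"
  proof (rule always_eventually, rule allI)
    fix t
    interpret prob_space "posterior_marginal (h t) a" by (rule prob_space_posterior_marginal)
    have "1 - prob {x. \<epsilon> \<le> \<bar>x - m\<bar>} = prob (space (posterior_marginal (h t) a) - {x. \<epsilon> \<le> \<bar>x - m\<bar>})"
      by (rule prob_compl[symmetric]) simp
    also have "\<dots> \<le> prob B"
      using B by (intro finite_measure_mono) force+
    finally show "1 - prob {x. \<epsilon> \<le> \<bar>x - m\<bar>} \<le> prob B" .
  qed
  show "eventually (\<lambda>t. measure (posterior_marginal (h t) a) B \<le> 1) F"
    by (intro always_eventually allI prob_space.prob_le_1 prob_space_posterior_marginal)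
qed simp

lemma pmf_Arm1: "pmf p Arm1 = 1 - pmf p Arm2"
proof -
  have "(\<Sum>a\<in>UNIV. pmf p a) = 1" by (rule sum_pmf_eq_1) auto
  then show ?thesis by (simp add: UNIV_arm)
qed

lemma thompson_sampling_tendsto_0:
  assumes TS: "thompson_sampling \<pi>"
    and "\<And>a. filterlim (\<lambda>t. pulls a (h t)) at_top F"
    and "\<And>a. ((\<lambda>t. emp_mean a (h t)) \<longlongrightarrow> \<mu> a) F"
    and "\<mu> Arm2 < \<mu> Arm1"
  shows "((\<lambda>t. pmf (\<pi> (h t)) Arm2) \<longlongrightarrow> 0) F"
proof -
  define x where "x = (\<mu> Arm1 + \<mu> Arm2) / 2"
  define \<epsilon> where "\<epsilon> = (\<mu> Arm1 - \<mu> Arm2) / 2"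
  have \<epsilon>: "\<epsilon> > 0" using assms(4) by (simp add: \<epsilon>_def)
  let ?q = "\<lambda>t. measure (posterior_marginal (h t) Arm1) {x..} * measure (posterior_marginal (h
      t) Arm2) {..<x}"
  have "(?q \<longlongrightarrow> 1 * 1) F"
    by (intro tendsto_mult posterior_marginal_tendsto_1[OF assms(2,3) \<epsilon>])
       (auto simp: x_def \<epsilon>_def abs_if field_simps split: if_splits)
  then have lim: "((\<lambda>t. 1 - ?q t) \<longlongrightarrow> 0) F"
    using tendsto_diff[OF tendsto_const[of 1], of ?q 1 F] by simp
  have "pmf (\<pi> (h t)) Arm2 \<le> 1 - ?q t" for t
    using thompson_sampling_ge[OF TS, of Arm1 Arm2 "h t" x] by (simp add: pmf_Arm1)
  then show ?thesis
    by (intro Lim_null_comparison[OF always_eventually lim]) auto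
qed

text \<open>The posterior of \<open>b\<close> is eventually one fixed Beta law with mass
  \<open>q > 0\<close> above \<open>x\<close>, and the sample of \<open>c\<close> falls below
  \<open>x > m\<close> with probability at least one half.\<close>

lemma thompson_sampling_explores:
  assumes TS: "thompson_sampling \<pi>" and "b \<noteq> c"
    and "filterlim (\<lambda>t. pulls c (h t)) at_top F"
    and "((\<lambda>t. emp_mean c (h t)) \<longlongrightarrow> m) F" and "m < 1"
    and const: "eventually (\<lambda>t. pulls b (h t) = n \<and> successes b (h t) = s) F"
    and "F \<noteq> bot"
  shows "\<exists>\<delta>>0. eventually (\<lambda>t. \<delta> \<le> pmf (\<pi> (h t)) b) F"
proof -
  define x where "x = (m + 1) / 2"
  define \<epsilon> where "\<epsilon> = (1 - m) / 2"
  have \<epsilon>: "\<epsilon> > 0" "x < 1" using \<open>m < 1\<close> by (auto simp: \<epsilon>_def x_def)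
  define q where "q = measure (beta_measure (1 + real s) (1 + real n - real s)) {x..}"
  \<comment> \<open>A nontrivial filter provides an actual history with these counts, which makes
    the second Beta parameter positive.\<close>
  have "s \<le> n"
    using eventually_happens'[OF \<open>F \<noteq> bot\<close> const] successes_le_pulls by auto
  then have q: "q > 0"
    unfolding q_def using \<epsilon> by (intro beta_measure_atLeast_pos) auto
  have "((\<lambda>t. measure (posterior_marginal (h t) c) {..<x}) \<longlongrightarrow> 1) F"
    by (intro posterior_marginal_tendsto_1[OF assms(3,4) \<epsilon>(1)])
       (auto simp: x_def \<epsilon>_def abs_if field_simps split: if_splits)
  then have "eventually (\<lambda>t. measure (posterior_marginal (h t) c) {..<x} > 1 / 2) F"
    by (rule order_tendstoD) simp
  then have "eventually (\<lambda>t. q / 2 \<le> pmf (\<pi> (h t)) b) F"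
    using const
  proof eventually_elim
    case (elim t)
    have "q * (1 / 2) \<le> measure (posterior_marginal (h t) b) {x..} * measure (posterior_marginal
        (h t) c) {..<x}"
      using elim q by (intro mult_mono) (auto simp: q_def)
    also have "\<dots> \<le> pmf (\<pi> (h t)) b"
      by (rule thompson_sampling_ge[OF TS \<open>b \<noteq> c\<close>])
    finally show ?case by simp
  qed
  then show ?thesis using q by (intro exI[of _ "q / 2"]) auto
qed

section \<open>Relative entropy and the weights of MED\<close>

lemma kl_real:
  assumes "0 \<le> p" "p \<le> 1" "0 < q" "q < 1"
  shows "kl p q = ereal (p * ln (p / q) + (1 - p) * ln ((1 - p) / (1 - q)))"
  using assms by (auto simp: kl_def xlog_def)

lemma kl_self [simp]: "kl p p = 0"
  by (auto simp: kl_def xlog_def)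

text \<open>This is \<open>ln x \<le> x - 1\<close> at \<open>x = q / p\<close>. Adding it for
  \<open>(p, q)\<close> and \<open>(1 - p, 1 - q)\<close> cancels the linear terms and gives Gibbs'
  inequality; the strict form below gives positivity for distinct means.\<close>

lemma mult_ln_divide_ge:
  fixes p q :: real
  assumes "0 \<le> p" "0 < q"
  shows "p * ln (p / q) \<ge> p - q"
proof (cases "p = 0")
  case False
  then have "ln (q / p) \<le> q / p - 1"
    using assms by (intro ln_le_minus_one) auto
  then have "p * ln (q / p) \<le> p * (q / p - 1)"
    using assms by (intro mult_left_mono) auto
  then show ?thesis
    using False assms by (simp add: ln_div algebra_simps)
qed (use assms in auto)

lemma mult_ln_divide_gt:
  fixes p q :: real
  assumes "0 < p" "0 < q" "p \<noteq> q"
  shows "p * ln (p / q) > p - q"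
proof -
  have "ln (q / p) < q / p - 1"
    using assms ln_le_minus_one[of "q / p"] ln_eq_minus_one[of "q / p"]
    by (auto simp: less_le)
  then have "p * ln (q / p) < p * (q / p - 1)"
    using assms by (intro mult_strict_left_mono) auto
  then show ?thesis
    using assms by (simp add: ln_div algebra_simps)
qed

lemma exp_minus_le_1:
  assumes "x \<ge> 0"
  shows "exp_minus x \<le> 1"
  using assms by (cases x) (auto simp: exp_minus_def)

lemma kl_nonneg:
  assumes "0 \<le> p" "p \<le> 1" "0 \<le> q" "q \<le> 1"
  shows "kl p q \<ge> 0"
proof (cases "0 < q \<and> q < 1")
  case True
  then show ?thesis
    using assms mult_ln_divide_ge[of p q] mult_ln_divide_ge[of "1 - p" "1 - q"]
    by (simp add: kl_real)
next
  case False
  \<comment> \<open>At the endpoints either the divergence is infinite, or \<open>p = q\<close> and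
    it is 0.\<close>
  then have "q = 0 \<or> q = 1" using assms by auto
  then show ?thesis
    using assms by (auto simp: kl_def xlog_def)
qed

lemma best_emp_mean_bounds: "0 \<le> best_emp_mean h" "best_emp_mean h \<le> 1"
  using emp_mean_bounds by (auto simp: best_emp_mean_def max_def)

lemma med_weight_le_1: "med_weight h a \<le> 1"
  unfolding med_weight_def
  by (intro exp_minus_le_1 ereal_0_le_mult kl_nonneg emp_mean_bounds best_emp_mean_bounds) auto

lemma med_weight_nonneg: "0 \<le> med_weight h a"
  by (simp add: med_weight_def exp_minus_def)

lemma med_weight_best:
  assumes "emp_mean a h = best_emp_mean h"
  shows "med_weight h a = 1"
  using assms by (simp add: med_weight_def exp_minus_def)

text \<open>As the empirical mean is at most the best one \<open>q\<close>, the first term of the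
  divergence is at most 0 and the second at most \<open>- ln (1 - q)\<close>. The bound serves an
  arm whose pull count no longer grows.\<close>

lemma med_weight_ge:
  assumes "best_emp_mean h \<le> y" "y < 1"
  shows "med_weight h a \<ge> (1 - y) ^ pulls a h"
proof -
  let ?p = "emp_mean a h" and ?q = "best_emp_mean h"
  have y: "0 \<le> y" using assms best_emp_mean_bounds[of h] by linarith
  have pq: "0 \<le> ?p" "?p \<le> ?q"
    using emp_mean_bounds[of a h] by (cases a; auto simp: best_emp_mean_def)+
  show ?thesis
  proof (cases "?p = ?q")
    \<comment> \<open>Equality covers \<open>?q = 0\<close>; otherwise \<open>?q\<close> lies
      strictly between 0 and 1 and the divergence is a real number.\<close>
    case True
    then show ?thesis using assms y by (simp add: med_weight_best power_le_one)
  next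
    case False
    then have q: "0 < ?q" "?q < 1" "?p < 1" using pq assms by auto
    have "?p * ln (?p / ?q) \<le> 0"
      using pq q by (cases "?p = 0") (auto simp: mult_le_0_iff ln_le_zero_iff)
    moreover have "(1 - ?p) * ln ((1 - ?p) / (1 - ?q)) \<le> 1 * - ln (1 - ?q)"
      using pq q by (intro mult_mono) (auto simp: ln_div)
    ultimately have "pulls a h * (?p * ln (?p / ?q) + (1 - ?p) * ln ((1 - ?p) / (1 - ?q)))
        \<le> pulls a h * (- ln (1 - ?q))"
      by (intro mult_left_mono) auto
    then have "exp (pulls a h * ln (1 - ?q)) \<le> med_weight h a"
      using pq q by (simp add: med_weight_def kl_real exp_minus_def)
    moreover have "exp (pulls a h * ln (1 - ?q)) = (1 - ?q) ^ pulls a h"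
      using q by (simp add: exp_of_nat_mult)
    moreover have "(1 - y) ^ pulls a h \<le> (1 - ?q) ^ pulls a h"
      using assms by (intro power_mono) auto
    ultimately show ?thesis by simp
  qed
qed

lemma med_pmf:
  assumes "med \<pi>" "\<And>a. pulls a h > 0"
  shows "pmf (\<pi> h) a = med_weight h a / (med_weight h Arm1 + med_weight h Arm2)"
proof -
  have "\<not> (\<exists>a. pulls a h = 0)" using assms(2) by (metis less_numeral_extra(3))
  then have "pmf (\<pi> h) a = med_weight h a / (\<Sum>b\<in>UNIV. med_weight h b)"
    using assms(1) unfolding med_def by presburger
  then show ?thesis by (simp add: UNIV_arm)
qed

lemma med_tendsto_0:
  assumes med: "med \<pi>"
    and pulls: "\<And>a. filterlim (\<lambda>t. pulls a (h t)) at_top F"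
    and mean: "\<And>a. ((\<lambda>t. emp_mean a (h t)) \<longlongrightarrow> \<mu> a) F"
    and \<mu>: "0 < \<mu> Arm2" "\<mu> Arm2 < \<mu> Arm1" "\<mu> Arm1 < 1"
  shows "((\<lambda>t. pmf (\<pi> (h t)) Arm2) \<longlongrightarrow> 0) F"
proof -
  \<comment> \<open>The real-valued form of \<open>kl\<close>, continuous at the true means and
    positive there, so that its product with the pull count tends to infinity.\<close>
  define K where "K = (\<lambda>p q :: real. p * ln (p / q) + (1 - p) * ln ((1 - p) / (1 - q)))"
  let ?p = "\<lambda>t. emp_mean Arm2 (h t)" and ?q = "\<lambda>t. emp_mean Arm1 (h t)"
  have "((\<lambda>t. K (?p t) (?q t)) \<longlongrightarrow> K (\<mu> Arm2) (\<mu> Arm1)) F"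
    unfolding K_def using \<mu> by (intro tendsto_intros mean) auto
  moreover have "K (\<mu> Arm2) (\<mu> Arm1) > 0"
    using mult_ln_divide_gt[of "\<mu> Arm2" "\<mu> Arm1"] mult_ln_divide_gt[of "1 - \<mu> Arm2" "1 - \<mu> Arm1"] \<mu>
    by (simp add: K_def)
  moreover have "filterlim (\<lambda>t. real (pulls Arm2 (h t))) at_top F"
    by (rule filterlim_compose[OF filterlim_real_sequentially pulls])
  ultimately have "filterlim (\<lambda>t. K (?p t) (?q t) * real (pulls Arm2 (h t))) at_top F"
    by (rule filterlim_tendsto_pos_mult_at_top)
  then have "filterlim (\<lambda>t. - (K (?p t) (?q t) * real (pulls Arm2 (h t)))) at_bot F"
    by (simp add: filterlim_uminus_at_top)
  then have lim: "((\<lambda>t. exp (- (K (?p t) (?q t) * real (pulls Arm2 (h t))))) \<longlongrightarrow> 0) F"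
    by (rule filterlim_compose[OF exp_at_bot])
  have "eventually (\<lambda>t. ?p t < (\<mu> Arm1 + \<mu> Arm2) / 2) F" "eventually (\<lambda>t. ?p t > 0) F"
    "eventually (\<lambda>t. ?q t > (\<mu> Arm1 + \<mu> Arm2) / 2) F" "eventually (\<lambda>t. ?q t < 1) F"
    using \<mu> by (intro order_tendstoD[OF mean]; simp)+
  moreover have "eventually (\<lambda>t. pulls a (h t) > 0) F" for a
    using pulls[of a, unfolded filterlim_at_top, rule_format, of 1] by eventually_elim simp
  note this[of Arm1] this[of Arm2]
  ultimately have "eventually (\<lambda>t. pmf (\<pi> (h t)) Arm2
      \<le> exp (- (K (?p t) (?q t) * real (pulls Arm2 (h t))))) F"
  proof eventually_elim
    case (elim t)
    \<comment> \<open>Once the empirical means are ordered like the true ones, the first arm has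
      weight 1 and the probability of the second has the form
      \<open>w / (1 + w) \<le> w\<close>.\<close>
    have best: "best_emp_mean (h t) = ?q t"
      using elim by (auto simp: best_emp_mean_def)
    have "pulls a (h t) > 0" for a using elim by (cases a) auto
    then have "pmf (\<pi> (h t)) Arm2 = med_weight (h t) Arm2 / (1 + med_weight (h t) Arm2)"
      using med_pmf[OF med] by (simp add: med_weight_best best)
    also have "\<dots> \<le> med_weight (h t) Arm2 / 1"
      using med_weight_nonneg[of "h t" Arm2] by (intro divide_left_mono) auto
    also have "med_weight (h t) Arm2 = exp (- (K (?p t) (?q t) * real (pulls Arm2 (h t))))"
      using elim by (simp add: med_weight_def best kl_real exp_minus_def K_def mult.commute)
    finally show ?case by simp
  qed
  then show ?thesis
    by (rule tendsto_sandwich[OF _ _ tendsto_const lim, rotated]) auto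
qed

lemma med_explores:
  assumes med: "med \<pi>" and "b \<noteq> c"
    and pulls: "filterlim (\<lambda>t. pulls c (h t)) at_top F"
    and mean: "((\<lambda>t. emp_mean c (h t)) \<longlongrightarrow> m) F" and "m < 1"
    and const: "eventually (\<lambda>t. pulls b (h t) = n \<and> successes b (h t) = s) F"
  shows "\<exists>\<delta>>0. eventually (\<lambda>t. \<delta> \<le> pmf (\<pi> (h t)) b) F"
proof -
  have arms: "a = b \<or> a = c" for a using \<open>b \<noteq> c\<close> by (cases a; cases b; cases c) auto
  have pc: "eventually (\<lambda>t. pulls c (h t) > 0) F"
    using pulls[unfolded filterlim_at_top, rule_format, of 1] by eventually_elim simp
  consider (unpulled) "n = 0" | (one) "n > 0" "s = n" | (less) "n > 0" "s \<noteq> n" by auto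
  then show ?thesis
  proof cases
    case unpulled
    have "eventually (\<lambda>t. 1 \<le> pmf (\<pi> (h t)) b) F"
      using const pc
    proof eventually_elim
      case (elim t)
      then have "set_pmf (\<pi> (h t)) \<subseteq> {a. pulls a (h t) = 0}"
        using med unpulled unfolding med_def by metis
      also have "\<dots> \<subseteq> {b}"
      proof
        fix a assume "a \<in> {a. pulls a (h t) = 0}"
        then show "a \<in> {b}" using elim arms[of a] by auto
      qed
      finally have "\<pi> (h t) = return_pmf b" by (simp add: set_pmf_subset_singleton)
      then show ?case by simp
    qed
    then show ?thesis by (intro exI[of _ 1]) auto
  next
    case one
    have "eventually (\<lambda>t. 1 / 2 \<le> pmf (\<pi> (h t)) b) F"
      using const pc
    proof eventually_elim
      case (elim t)
      have "pulls a (h t) > 0" for a using elim one arms[of a] by auto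
      note med_pmf[OF med this, of b]
      moreover have "emp_mean b (h t) = 1" using elim one by (simp add: emp_mean_def)
      then have "emp_mean b (h t) = best_emp_mean (h t)"
        using emp_mean_bounds[of _ "h t"] best_emp_mean_bounds[of "h t"]
        by (cases b) (auto simp: best_emp_mean_def)
      then have "med_weight (h t) b = 1" by (rule med_weight_best)
      ultimately show ?case
        using med_weight_le_1[of "h t" c] med_weight_nonneg[of "h t" c] \<open>b \<noteq> c\<close>
        by (cases b; cases c) (auto simp: pos_le_divide_eq)
    qed
    then show ?thesis by (intro exI[of _ "1/2"]) auto
  next
    case less
    define y where "y = max ((m + 1) / 2) (real s / real n)"
    show ?thesis
    proof (cases "s \<le> n")
      case True
      then have y: "y < 1" using less \<open>m < 1\<close> by (auto simp: y_def)
      have "eventually (\<lambda>t. emp_mean c (h t) < (m + 1) / 2) F"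
        using \<open>m < 1\<close> by (intro order_tendstoD[OF mean]) auto
      then have "eventually (\<lambda>t. (1 - y) ^ n / 2 \<le> pmf (\<pi> (h t)) b) F"
        using const pc
      proof eventually_elim
        case (elim t)
        have "pulls a (h t) > 0" for a using elim less arms[of a] by auto
        note pmf = med_pmf[OF med this, of b]
        have "emp_mean a (h t) \<le> y" for a
        proof -
          have "emp_mean b (h t) \<le> y" "emp_mean c (h t) \<le> y"
            using elim by (auto simp: y_def emp_mean_def[of b] le_max_iff_disj)
          then show ?thesis using arms[of a] by auto
        qed
        then have "best_emp_mean (h t) \<le> y" by (simp add: best_emp_mean_def)
        then have w: "(1 - y) ^ n \<le> med_weight (h t) b"
          using med_weight_ge[of "h t" y b] y elim by simp
        moreover have "0 < (1 - y) ^ n" using y by simp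
        ultimately have "0 < med_weight (h t) b" by simp
        moreover have "med_weight (h t) Arm1 + med_weight (h t) Arm2 > 0"
          using \<open>0 < med_weight (h t) b\<close> med_weight_nonneg[of "h t" Arm1] med_weight_nonneg[of
              "h t" Arm2]
          by (cases b) auto
        moreover have "med_weight (h t) Arm1 + med_weight (h t) Arm2 \<le> 2"
          using med_weight_le_1[of "h t" Arm1] med_weight_le_1[of "h t" Arm2] by simp
        ultimately have "med_weight (h t) b / 2 \<le> pmf (\<pi> (h t)) b"
          unfolding pmf by (intro divide_left_mono) auto
        then show ?case using w by simp
      qed
      then show ?thesis using y by (intro exI[of _ "(1 - y) ^ n / 2"]) auto
    next
      \<comment> \<open>No history has more successes than pulls, so the filter is trivial and any
        bound holds eventually.\<close>
      case False
      then have "eventually (\<lambda>t. False) F"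
        by (intro eventually_mono[OF const]) (use successes_le_pulls in blast)
      then have "eventually (\<lambda>t. 1 \<le> pmf (\<pi> (h t)) b) F"
        by (rule eventually_mono) simp
      then show ?thesis by (intro exI[of _ 1]) simp
    qed
  qed
qed

subsection \<open>Finite-horizon laws and Ville's inequality\<close>

context bandit_process
begin

abbreviation H :: "nat \<Rightarrow> 'w \<Rightarrow> history" where
  "H \<equiv> history_before A R"

lemma history_before_Suc: "t \<ge> 1 \<Longrightarrow> H (Suc t) \<omega> = H t \<omega> @ [(A t \<omega>, R t \<omega>)]"
  by (simp add: history_before_def)

lemma history_before_1 [simp]: "H (Suc 0) \<omega> = []"
  by (simp add: history_before_def)

lemma length_history_before [simp]: "length (H t \<omega>) = t - 1"
  by (simp add: history_before_def)

lemma take_history_before: "1 \<le> s \<Longrightarrow> s \<le> t \<Longrightarrow> take (s - 1) (H t \<omega>) = H s \<omega>"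
  by (simp add: history_before_def take_map)

lemma nth_history_before: "1 \<le> s \<Longrightarrow> s < t \<Longrightarrow> H t \<omega> ! (s - 1) = (A s \<omega>, R s \<omega>)"
  using nth_upt[of 1 "s - 1" t] by (simp add: history_before_def)

lemma measurable_history_before [measurable]: "H t \<in> measurable M (count_space UNIV)"
proof (induction t)
  case 0
  then show ?case by (simp add: history_before_def)
next
  case (Suc t)
  show ?case
  proof (cases "t \<ge> 1")
    case True
    have "(\<lambda>\<omega>. h @ [(a, R t \<omega>)]) \<in> measurable M (count_space UNIV)" for h a
      by (rule measurable_compose[OF measurable_reward[OF True]]) simp
    then have "(\<lambda>\<omega>. h @ [(A t \<omega>, R t \<omega>)]) \<in> measurable M (count_space UNIV)" for h
      by (rule measurable_compose_countable[OF _ measurable_arm[OF True]])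
    then have "(\<lambda>\<omega>. H t \<omega> @ [(A t \<omega>, R t \<omega>)]) \<in> measurable M (count_space UNIV)"
      by (rule measurable_compose_countable[OF _ Suc.IH])
    then show ?thesis using True by (simp add: history_before_Suc)
  next
    case False
    then have "t = 0" by simp
    then show ?thesis by simp
  qed
qed

section \<open>Expectations as finite sums over histories\<close>

definition histories :: "nat \<Rightarrow> history set" where
  "histories t = {h. length h = t - 1}"

lemma finite_histories [simp]: "finite (histories t)"
proof -
  have "finite {h :: history. set h \<subseteq> UNIV \<and> length h = t - 1}"
    by (rule finite_lists_length_eq) simp
  then show ?thesis unfolding histories_def by (simp only: subset_UNIV simp_thms)
qed

text \<open>Only finitely many histories have a given length, so \<open>H t\<close> takes finitely
  many values and every function of it is integrable. The event \<open>E\<close> leaves room for the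
  arm and the reward drawn at time \<open>t\<close>.\<close>

lemma
  fixes f :: "history \<Rightarrow> real"
  assumes "E \<in> events"
  shows integrable_history_indicator: "integrable M (\<lambda>\<omega>. f (H t \<omega>) * indicator E \<omega>)"
    and expectation_history_indicator: "expectation (\<lambda>\<omega>. f (H t \<omega>) * indicator E \<omega>) =
      (\<Sum>h\<in>histories t. f h * prob {\<omega>\<in>space M. H t \<omega> = h \<and> \<omega> \<in> E})"
proof -
  note [measurable] = assms
  have eq: "f (H t \<omega>) * indicator E \<omega> =
      (\<Sum>h\<in>histories t. f h * indicator {\<omega>\<in>space M. H t \<omega> = h \<and> \<omega> \<in> E} \<omega>)"
    if "\<omega> \<in> space M" for \<omega>
  proof -
    have "(\<Sum>h\<in>histories t. f h * indicator {\<omega>\<in>space M. H t \<omega> = h \<and> \<omega> \<in> E} \<omega>) =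
      (\<Sum>h\<in>histories t. if h = H t \<omega> then f h * indicator E \<omega> else 0)"
      using that by (intro sum.cong) (auto simp: indicator_def)
    also have "\<dots> = f (H t \<omega>) * indicator E \<omega>"
      by (subst sum.delta) (simp, simp add: histories_def)
    finally show ?thesis by simp
  qed
  have int: "integrable M (\<lambda>\<omega>. f h * indicator {\<omega>\<in>space M. H t \<omega> = h \<and> \<omega> \<in> E} \<omega>)" for h
    by (intro integrable_mult_right integrable_real_indicator) (auto simp: emeasure_eq_measure)
  show "integrable M (\<lambda>\<omega>. f (H t \<omega>) * indicator E \<omega>)"
    by (subst Bochner_Integration.integrable_cong[OF refl eq])
       (assumption, rule Bochner_Integration.integrable_sum, rule int)
  have "expectation (\<lambda>\<omega>. f (H t \<omega>) * indicator E \<omega>) =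
      expectation (\<lambda>\<omega>. \<Sum>h\<in>histories t. f h * indicator {\<omega>\<in>space M. H t \<omega> = h \<and> \<omega> \<in> E} \<omega>)"
    by (intro Bochner_Integration.integral_cong eq) auto
  also have "\<dots> = (\<Sum>h\<in>histories t. f h * prob {\<omega>\<in>space M. H t \<omega> = h \<and> \<omega> \<in> E})"
    using int by (subst Bochner_Integration.integral_sum) (auto intro!: sum.cong arg_cong[where
        f = prob])
  finally show "expectation (\<lambda>\<omega>. f (H t \<omega>) * indicator E \<omega>) =
      (\<Sum>h\<in>histories t. f h * prob {\<omega>\<in>space M. H t \<omega> = h \<and> \<omega> \<in> E})" .
qed

lemma integrable_history: "integrable M (\<lambda>\<omega>. f (H t \<omega>) :: real)"
  and expectation_history:
    "expectation (\<lambda>\<omega>. f (H t \<omega>)) = (\<Sum>h\<in>histories t. f h * prob {\<omega>\<in>space M. H t \<omega> = h})"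
proof -
  have eq: "f (H t \<omega>) = f (H t \<omega>) * indicator (space M) \<omega>" if "\<omega> \<in> space M" for \<omega>
    using that by simp
  show "integrable M (\<lambda>\<omega>. f (H t \<omega>))"
    by (subst Bochner_Integration.integrable_cong[OF refl eq]) (auto intro:
        integrable_history_indicator)
  show "expectation (\<lambda>\<omega>. f (H t \<omega>)) = (\<Sum>h\<in>histories t. f h * prob {\<omega>\<in>space M. H t \<omega> = h})"
    by (subst Bochner_Integration.integral_cong[OF refl eq], assumption)
       (auto simp: expectation_history_indicator intro!: sum.cong arg_cong[where f = prob])
qed

text \<open>The tower property in elementary form: \<open>arm_law\<close>, summed over histories,
  replaces the indicator of the next arm by its conditional probability.\<close>

lemma expectation_arm:
  fixes f :: "history \<Rightarrow> real"
  assumes "t \<ge> 1"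
  shows "expectation (\<lambda>\<omega>. f (H t \<omega>) * indicator {\<omega>\<in>space M. A t \<omega> = a} \<omega>) =
     expectation (\<lambda>\<omega>. f (H t \<omega>) * pmf (\<pi> (H t \<omega>)) a)"
proof -
  note [measurable] = measurable_arm[OF assms]
  have "expectation (\<lambda>\<omega>. f (H t \<omega>) * indicator {\<omega>\<in>space M. A t \<omega> = a} \<omega>) =
     (\<Sum>h\<in>histories t. f h * prob {\<omega>\<in>space M. H t \<omega> = h \<and> A t \<omega> = a})"
    by (subst expectation_history_indicator)
       (auto intro!: sum.cong arg_cong[where f = prob])
  also have "\<dots> = (\<Sum>h\<in>histories t. (f h * pmf (\<pi> h) a) * prob {\<omega>\<in>space M. H t \<omega> = h})"
    by (intro sum.cong) (auto simp: arm_law[OF assms])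
  also have "\<dots> = expectation (\<lambda>\<omega>. f (H t \<omega>) * pmf (\<pi> (H t \<omega>)) a)"
    by (rule expectation_history[symmetric])
  finally show ?thesis .
qed

text \<open>The one-step transition operator of the history process. It turns the supermartingale
  property into the pointwise inequality \<open>step_mean f h \<le> f h\<close>.\<close>

definition step_mean :: "(history \<Rightarrow> real) \<Rightarrow> history \<Rightarrow> real" where
  "step_mean f h = (\<Sum>a\<in>UNIV. \<Sum>r\<in>UNIV.
     pmf (\<pi> h) a * pmf (bernoulli_pmf (\<mu> a)) r * f (h @ [(a, r)]))"

lemma expectation_history_Suc:
  assumes "t \<ge> 1"
  shows "expectation (\<lambda>\<omega>. f (H (Suc t) \<omega>)) = expectation (\<lambda>\<omega>. step_mean f (H t \<omega>))"
proof -
  note [measurable] = measurable_arm[OF assms] measurable_reward[OF assms]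
  let ?E = "\<lambda>a r. {\<omega>\<in>space M. A t \<omega> = a \<and> R t \<omega> = r}"
  have eq: "f (H (Suc t) \<omega>) = (\<Sum>a\<in>UNIV. \<Sum>r\<in>UNIV. f (H t \<omega> @ [(a, r)]) * indicator (?E a r) \<omega>)"
    if "\<omega> \<in> space M" for \<omega>
    using that assms unfolding UNIV_arm UNIV_bool
    by (cases "A t \<omega>"; cases "R t \<omega>") (auto simp: history_before_Suc simp del: sum_mult_indicator)
  have int: "integrable M (\<lambda>\<omega>. f (H t \<omega> @ [(a, r)]) * indicator (?E a r) \<omega>)" for a r
    by (rule integrable_history_indicator) measurable
  have "expectation (\<lambda>\<omega>. f (H (Suc t) \<omega>)) =
      expectation (\<lambda>\<omega>. \<Sum>a\<in>UNIV. \<Sum>r\<in>UNIV. f (H t \<omega> @ [(a, r)]) * indicator (?E a r) \<omega>)"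
    by (intro Bochner_Integration.integral_cong eq) auto
  also have "\<dots> = (\<Sum>a\<in>UNIV. \<Sum>r\<in>UNIV.
      expectation (\<lambda>\<omega>. f (H t \<omega> @ [(a, r)]) * indicator (?E a r) \<omega>))"
    using int by (simp del: sum_mult_indicator)
  also have "\<dots> = (\<Sum>a\<in>UNIV. \<Sum>r\<in>UNIV.
      expectation (\<lambda>\<omega>. pmf (\<pi> (H t \<omega>)) a * pmf (bernoulli_pmf (\<mu> a)) r * f (H t \<omega> @ [(a, r)])))"
  proof (intro sum.cong refl)
    fix a r
    have "expectation (\<lambda>\<omega>. f (H t \<omega> @ [(a, r)]) * indicator (?E a r) \<omega>) =
      (\<Sum>h\<in>histories t. f (h @ [(a, r)]) * prob {\<omega>\<in>space M. H t \<omega> = h \<and> A t \<omega> = a \<and> R t \<omega> = r})"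
      by (subst expectation_history_indicator)
         (auto intro!: sum.cong arg_cong[where f = prob])
    also have "\<dots> = (\<Sum>h\<in>histories t. (pmf (\<pi> h) a * pmf (bernoulli_pmf (\<mu> a)) r * f (h @ [(a, r)])) *
        prob {\<omega>\<in>space M. H t \<omega> = h})"
      by (intro sum.cong) (auto simp: arm_law[OF assms] reward_law[OF assms])
    also have "\<dots> = expectation (\<lambda>\<omega>. pmf (\<pi> (H t \<omega>)) a * pmf (bernoulli_pmf (\<mu> a)) r * f (H t \<omega> @
        [(a, r)]))"
      by (rule expectation_history[symmetric])
    finally show "expectation (\<lambda>\<omega>. f (H t \<omega> @ [(a, r)]) * indicator (?E a r) \<omega>) = \<dots>" .
  qed
  also have "\<dots> = expectation (\<lambda>\<omega>. step_mean f (H t \<omega>))"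
    unfolding step_mean_def
    using integrable_history[where t = t and f = "\<lambda>h. pmf (\<pi> h) a * pmf (bernoulli_pmf (\<mu> a)) r
        * f (h @ [(a, r)])" for a r]
    by simp
  finally show ?thesis .
qed

section \<open>Ville's maximal inequality\<close>

lemma expectation_superharmonic_le:
  assumes "t \<ge> 1" "\<And>h. step_mean f h \<le> f h" "\<And>h. g h \<ge> 0"
  shows "expectation (\<lambda>\<omega>. g (H t \<omega>) * f (H (Suc t) \<omega>)) \<le> expectation (\<lambda>\<omega>. g (H t \<omega>) * f (H t \<omega>))"
proof -
  \<comment> \<open>\<open>butlast\<close> recovers \<open>H t\<close> from
    \<open>H (Suc t)\<close>, so the weight becomes part of a single function of the later
    history.\<close>
  have "expectation (\<lambda>\<omega>. g (H t \<omega>) * f (H (Suc t) \<omega>)) =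
      expectation (\<lambda>\<omega>. g (butlast (H (Suc t) \<omega>)) * f (H (Suc t) \<omega>))"
    using assms(1) by (simp add: history_before_Suc)
  also have "\<dots> = expectation (\<lambda>\<omega>. step_mean (\<lambda>h. g (butlast h) * f h) (H t \<omega>))"
    by (rule expectation_history_Suc) fact
  also have "\<dots> = expectation (\<lambda>\<omega>. g (H t \<omega>) * step_mean f (H t \<omega>))"
    by (simp add: step_mean_def sum_distrib_left ac_simps)
  also have "\<dots> \<le> expectation (\<lambda>\<omega>. g (H t \<omega>) * f (H t \<omega>))"
    using assms by (intro integral_mono mult_left_mono integrable_history[where f = "\<lambda>h. g h * f h"]
       integrable_history[where f = "\<lambda>h. g h * step_mean f h"]) auto
  finally show ?thesis .
qed

text \<open>The left side is a lower bound for the expectation of \<open>f\<close> stopped on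
  reaching \<open>c\<close>: stopped paths count with \<open>c\<close>, the others with their
  current value. The second term restricts only the times before \<open>t\<close>, so
  \<open>f\<close> may have reached \<open>c\<close> at \<open>t\<close> itself; the induction step
  moves exactly this part into the first term.\<close>

lemma Ville_finite:
  assumes sup: "\<And>h. step_mean f h \<le> f h" and nonneg: "\<And>h. f h \<ge> 0" and "c > 0" "t \<ge> 1"
  shows "c * prob {\<omega>\<in>space M. \<exists>u\<in>{1..<t}. c \<le> f (H u \<omega>)} +
    expectation (\<lambda>\<omega>. of_bool (\<forall>u\<in>{1..<t}. f (H u \<omega>) < c) * f (H t \<omega>)) \<le> f []"
  using \<open>t \<ge> 1\<close>
proof (induction t rule: nat_induct_at_least)
  case base
  then show ?case by (simp add: prob_space)
next
  case (Suc t)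
  \<comment> \<open>\<open>g\<close> says that \<open>c\<close> is not reached up to and including
    \<open>t\<close>, \<open>g'\<close> only before \<open>t\<close>; reading them off prefixes
    makes them functions of \<open>H t\<close>. They differ on the first-passage event
    \<open>E\<close>, where \<open>f\<close> pays for \<open>c\<close>.\<close>
  define g where "g = (\<lambda>h. of_bool (\<forall>u\<in>{1..<Suc t}. f (take (u - 1) h) < c) :: real)"
  have g: "g (H t \<omega>) = of_bool (\<forall>u\<in>{1..<Suc t}. f (H u \<omega>) < c)" for \<omega>
    unfolding g_def by (intro arg_cong[where f = of_bool] ball_cong) (auto simp:
        take_history_before[simplified])
  define g' where "g' = (\<lambda>h. of_bool (\<forall>u\<in>{1..<t}. f (take (u - 1) h) < c) :: real)"
  have g': "g' (H t \<omega>) = of_bool (\<forall>u\<in>{1..<t}. f (H u \<omega>) < c)" for \<omega>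
    unfolding g'_def by (intro arg_cong[where f = of_bool] ball_cong) (auto simp:
        take_history_before[simplified])
  define E where "E = {\<omega>\<in>space M. (\<forall>u\<in>{1..<t}. f (H u \<omega>) < c) \<and> c \<le> f (H t \<omega>)}"
  have [measurable]: "E \<in> events" unfolding E_def by measurable
  have "{\<omega>\<in>space M. \<exists>u\<in>{1..<Suc t}. c \<le> f (H u \<omega>)} = {\<omega>\<in>space M. \<exists>u\<in>{1..<t}. c \<le> f (H u \<omega>)} \<union> E"
    using \<open>t \<ge> 1\<close> by (auto simp: E_def less_Suc_eq not_le) (meson atLeastLessThan_iff not_less)
  then have "prob {\<omega>\<in>space M. \<exists>u\<in>{1..<Suc t}. c \<le> f (H u \<omega>)} \<le>
      prob {\<omega>\<in>space M. \<exists>u\<in>{1..<t}. c \<le> f (H u \<omega>)} + prob E"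
    by (simp add: measure_Un_le)
  then have 1: "c * prob {\<omega>\<in>space M. \<exists>u\<in>{1..<Suc t}. c \<le> f (H u \<omega>)} \<le>
      c * prob {\<omega>\<in>space M. \<exists>u\<in>{1..<t}. c \<le> f (H u \<omega>)} + c * prob E"
    using \<open>c > 0\<close> by (simp flip: distrib_left)
  have "expectation (\<lambda>\<omega>. g (H t \<omega>) * f (H (Suc t) \<omega>)) + c * prob E \<le>
    expectation (\<lambda>\<omega>. g (H t \<omega>) * f (H t \<omega>)) + c * prob E"
    using expectation_superharmonic_le[OF \<open>t \<ge> 1\<close> sup, of g] by (simp add: g_def)
  also have "\<dots> = expectation (\<lambda>\<omega>. g (H t \<omega>) * f (H t \<omega>) + c * indicator E \<omega>)"
    using integrable_history[where f = "\<lambda>h. g h * f h"] by (simp add: emeasure_eq_measure)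
  also have "\<dots> \<le> expectation (\<lambda>\<omega>. g' (H t \<omega>) * f (H t \<omega>))"
  proof (rule integral_mono)
    show "integrable M (\<lambda>\<omega>. g (H t \<omega>) * f (H t \<omega>) + c * indicator E \<omega>)"
      using integrable_history[where f = "\<lambda>h. g h * f h"] by (simp add: emeasure_eq_measure)
    show "integrable M (\<lambda>\<omega>. g' (H t \<omega>) * f (H t \<omega>))"
      by (rule integrable_history)
    fix \<omega> assume \<omega>: "\<omega> \<in> space M"
    show "g (H t \<omega>) * f (H t \<omega>) + c * indicator E \<omega> \<le> g' (H t \<omega>) * f (H t \<omega>)"
    proof (cases "\<omega> \<in> E")
      case True
      then have "t \<in> {1..<Suc t}" "\<not> f (H t \<omega>) < c" using \<open>t \<ge> 1\<close> by (auto simp: E_def)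
      then have "g (H t \<omega>) = 0" unfolding g by auto
      then show ?thesis using True by (simp add: E_def g')
    next
      case False
      have "g (H t \<omega>) \<le> g' (H t \<omega>)" unfolding g g' by (auto simp: less_Suc_eq)
      then show ?thesis using False nonneg by (simp add: mult_right_mono)
    qed
  qed
  finally show ?case
    using 1 Suc.IH by (simp add: g g')
qed

lemma Ville:
  assumes sup: "\<And>h. step_mean f h \<le> f h" and nonneg: "\<And>h. f h \<ge> 0" and "c > 0"
  shows "prob {\<omega>\<in>space M. \<exists>t\<ge>1. c \<le> f (H t \<omega>)} \<le> f [] / c"
proof -
  let ?B = "\<lambda>t. {\<omega>\<in>space M. \<exists>u\<in>{1..<Suc t}. c \<le> f (H u \<omega>)}"
  have "(\<lambda>t. prob (?B t)) \<longlonglongrightarrow> prob (\<Union>t. ?B t)"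
  proof (rule finite_Lim_measure_incseq)
    have "?B t \<in> events" for t by measurable
    then show "range ?B \<subseteq> events" by auto
    show "incseq ?B" by (rule incseq_SucI) auto
  qed
  moreover have "(\<Union>t. ?B t) = {\<omega>\<in>space M. \<exists>t\<ge>1. c \<le> f (H t \<omega>)}"
  proof -
    have *: "(\<exists>t. \<exists>u\<in>{1..<Suc t}. c \<le> f (H u \<omega>)) \<longleftrightarrow> (\<exists>t\<ge>1. c \<le> f (H t \<omega>))" for \<omega>
      by (meson atLeastLessThan_iff lessI)
    have "(\<Union>t. ?B t) = {\<omega>\<in>space M. \<exists>t. \<exists>u\<in>{1..<Suc t}. c \<le> f (H u \<omega>)}" by auto
    then show ?thesis by (simp only: *)
  qed
  moreover have "prob (?B t) \<le> f [] / c" for t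
  proof -
    have "0 \<le> expectation (\<lambda>\<omega>. of_bool (\<forall>u\<in>{1..<Suc t}. f (H u \<omega>) < c) * f (H (Suc t) \<omega>))"
      using nonneg by (intro integral_nonneg_AE) auto
    then show ?thesis
      using Ville_finite[OF sup nonneg \<open>c > 0\<close>, of "Suc t"] \<open>c > 0\<close> by (simp add: field_simps)
  qed
  ultimately show ?thesis
    by (metis (mono_tags, lifting) LIMSEQ_le_const2)
qed

end

subsection \<open>Almost sure behaviour of the statistics\<close>

text \<open>Hoeffding's lemma for a centred Bernoulli variable. The auxiliary inequality is applied
  to a nonnegative exponent; exchanging success and failure turns \<open>(p, l)\<close> into
  \<open>(1 - p, - l)\<close> and settles the other sign.\<close>

lemma bernoulli_mgf_le:
  fixes p l :: real
  assumes "0 \<le> p" "p \<le> 1"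
  shows "p * exp (l * (1 - p)) + (1 - p) * exp (- (l * p)) \<le> exp (l\<^sup>2 / 8)"
proof -
  have *: "q * exp (k * (1 - q)) + (1 - q) * exp (- (k * q)) \<le> exp (k\<^sup>2 / 8)"
    if "0 \<le> q" "q \<le> 1" "k \<ge> 0" for q k :: real
  proof -
    have pos: "1 + q * (exp k - 1) > 0"
      using that by (intro add_pos_nonneg mult_nonneg_nonneg) auto
    have "q * exp (k * (1 - q)) + (1 - q) * exp (- (k * q)) = exp (- k * q) * (1 + q * (exp k - 1))"
      by (simp add: algebra_simps exp_diff exp_minus field_simps)
    also have "\<dots> = exp (- k * q + ln (1 + q * (exp k - 1)))"
      using pos by (subst exp_add) simp
    also have "\<dots> \<le> exp (k\<^sup>2 / 8)"
      using Hoeffdings_lemma_aux[of k q] that by simp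
    finally show ?thesis .
  qed
  show ?thesis
  proof (cases "l \<ge> 0")
    case True
    then show ?thesis using *[of p l] assms by simp
  next
    case False
    then show ?thesis using *[of "1 - p" "- l"] assms by (simp add: algebra_simps)
  qed
qed

context bandit_process
begin

text \<open>Hoeffding's compensator \<open>l^2 / 8\<close> is charged per pull of \<open>a\<close>,
  not per round, so rounds of the other arm leave the value unchanged.\<close>

definition exp_supermartingale :: "real \<Rightarrow> arm \<Rightarrow> history \<Rightarrow> real" where
  "exp_supermartingale l a h =
     exp (l * (real (successes a h) - \<mu> a * real (pulls a h)) - l\<^sup>2 / 8 * real (pulls a h))"

lemma step_mean_add: "step_mean (\<lambda>h. f h + g h) h = step_mean f h + step_mean g h"
  by (simp add: step_mean_def sum.distrib distrib_left)

lemma step_mean_exp_supermartingale: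
  assumes \<mu>: "\<And>a. 0 \<le> \<mu> a" "\<And>a. \<mu> a \<le> 1"
  shows "step_mean (exp_supermartingale l a) h \<le> exp_supermartingale l a h"
proof -
  let ?U = "exp_supermartingale l a"
  have "(\<Sum>r\<in>UNIV. pmf (bernoulli_pmf (\<mu> b)) r * ?U (h @ [(b, r)])) \<le> ?U h" for b
  proof (cases "b = a")
    case True
    have "?U (h @ [(a, True)]) = ?U h * (exp (l * (1 - \<mu> a)) / exp (l\<^sup>2 / 8))"
      "?U (h @ [(a, False)]) = ?U h * (exp (- (l * \<mu> a)) / exp (l\<^sup>2 / 8))"
      by (simp_all add: exp_supermartingale_def exp_add[symmetric] exp_diff[symmetric]
          algebra_simps)
    then have "(\<Sum>r\<in>UNIV. pmf (bernoulli_pmf (\<mu> b)) r * ?U (h @ [(b, r)])) =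
      ?U h * ((\<mu> a * exp (l * (1 - \<mu> a)) + (1 - \<mu> a) * exp (- (l * \<mu> a))) / exp (l\<^sup>2 / 8))"
      using True \<mu> by (simp add: UNIV_bool add_divide_distrib distrib_left ac_simps)
    also have "\<dots> \<le> ?U h * 1"
      using bernoulli_mgf_le[of "\<mu> a" l] \<mu>
      by (intro mult_left_mono) (auto simp: exp_supermartingale_def)
    finally show ?thesis by simp
  next
    case False
    then show ?thesis
      using \<mu> by (simp add: UNIV_bool exp_supermartingale_def flip: distrib_right)
  qed
  then have "step_mean ?U h \<le> (\<Sum>b\<in>UNIV. pmf (\<pi> h) b * ?U h)"
    unfolding step_mean_def
    by (auto simp: mult.assoc sum_distrib_left[symmetric] intro!: sum_mono mult_left_mono)
  also have "\<dots> = ?U h"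
    by (simp add: sum_distrib_right[symmetric] sum_pmf_eq_1)
  finally show ?thesis .
qed

text \<open>Ville's bound is uniform in time, so all times with pull count \<open>n\<close> are
  handled without a union bound over \<open>t\<close>, and the result is summable in
  \<open>n\<close>.\<close>

lemma prob_deviation_le:
  assumes \<mu>: "\<And>a. 0 \<le> \<mu> a" "\<And>a. \<mu> a \<le> 1" and "\<epsilon> \<ge> 0"
  shows "prob {\<omega>\<in>space M. \<exists>t\<ge>1. pulls a (H t \<omega>) = n \<and>
      \<epsilon> * real n \<le> \<bar>real (successes a (H t \<omega>)) - \<mu> a * real n\<bar>} \<le> 2 * exp (- (2 * \<epsilon>\<^sup>2)) ^ n"
    (is "prob ?D \<le> _")
proof -
  \<comment> \<open>\<open>l = 4 * \<epsilon>\<close> maximises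
    \<open>l * \<epsilon> - l^2 / 8\<close>, with value \<open>2 * \<epsilon>^2\<close>, the
    exponent per pull in \<open>c\<close>. The two signs serve the two tails and give
    \<open>f [] = 2\<close>.\<close>
  define f where "f = (\<lambda>h. exp_supermartingale (4 * \<epsilon>) a h + exp_supermartingale (- (4 * \<epsilon>)) a h)"
  define c where "c = exp (2 * \<epsilon>\<^sup>2 * real n)"
  have sup: "step_mean f h \<le> f h" for h
    unfolding f_def step_mean_add by (intro add_mono step_mean_exp_supermartingale \<mu>)
  have nonneg: "f h \<ge> 0" for h by (simp add: f_def exp_supermartingale_def add_nonneg_nonneg)
  have "prob ?D \<le> prob {\<omega>\<in>space M. \<exists>t\<ge>1. c \<le> f (H t \<omega>)}"
  proof (rule finite_measure_mono)
    show "?D \<subseteq> {\<omega>\<in>space M. \<exists>t\<ge>1. c \<le> f (H t \<omega>)}"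
    proof clarify
      fix \<omega> t
      assume \<omega>: "\<omega> \<in> space M" "t \<ge> 1" "n = pulls a (H t \<omega>)"
        and dev: "\<epsilon> * real (pulls a (H t \<omega>)) \<le> \<bar>real (successes a (H t \<omega>)) - \<mu> a * real (pulls a
            (H t \<omega>))\<bar>"
      define d where "d = real (successes a (H t \<omega>)) - \<mu> a * real n"
      have fd: "f (H t \<omega>) = exp (4 * \<epsilon> * d - (4 * \<epsilon>)\<^sup>2 / 8 * real n) +
          exp (- (4 * \<epsilon>) * d - (- (4 * \<epsilon>))\<^sup>2 / 8 * real n)"
        by (simp only: f_def exp_supermartingale_def d_def \<omega>(3))
      have "\<epsilon> * (\<epsilon> * real n) \<le> \<epsilon> * \<bar>d\<bar>"
        using dev \<open>\<epsilon> \<ge> 0\<close> unfolding d_def \<omega>(3) by (rule mult_left_mono)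
      then have "2 * \<epsilon>\<^sup>2 * n \<le> 4 * \<epsilon> * \<bar>d\<bar> - (4 * \<epsilon>)\<^sup>2 / 8 * real n"
        by (simp add: power2_eq_square algebra_simps)
      then have "c \<le> exp (4 * \<epsilon> * \<bar>d\<bar> - (4 * \<epsilon>)\<^sup>2 / 8 * real n)"
        unfolding c_def by simp
      also have "\<dots> \<le> exp (4 * \<epsilon> * d - (4 * \<epsilon>)\<^sup>2 / 8 * real n) + exp (4 * \<epsilon> * (- d) - (4 * \<epsilon>)\<^sup>2 /
          8 * real n)"
      proof (cases "d \<ge> 0")
        case True
        then have "\<bar>d\<bar> = d" by simp
        then show ?thesis by (simp only: le_add_same_cancel1 exp_ge_zero)
      next
        case False
        then have "\<bar>d\<bar> = - d" by simp
        then show ?thesis by (simp only: le_add_same_cancel2 exp_ge_zero)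
      qed
      also have "\<dots> = f (H t \<omega>)"
        unfolding fd by (simp only: mult_minus_left mult_minus_right power2_minus)
      finally show "\<exists>t\<ge>1. c \<le> f (H t \<omega>)" using \<omega> by blast
    qed
  qed measurable
  also have "\<dots> \<le> f [] / c"
    by (rule Ville[OF sup nonneg]) (simp add: c_def)
  also have "\<dots> = 2 * exp (- (2 * \<epsilon>\<^sup>2)) ^ n"
  proof -
    have "exp (- (2 * \<epsilon>\<^sup>2)) ^ n = exp (- (2 * \<epsilon>\<^sup>2 * real n))"
      by (subst exp_of_nat_mult[symmetric]) (simp only: mult_minus_right mult.commute)
    also have "\<dots> = 1 / c"
      unfolding c_def by (simp only: exp_minus inverse_eq_divide)
    moreover have "f [] = 2"
      by (simp add: f_def exp_supermartingale_def)
    ultimately show ?thesis by simp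
  qed
  finally show ?thesis .
qed

lemma AE_emp_mean_tendsto:
  assumes \<mu>: "\<And>a. 0 \<le> \<mu> a" "\<And>a. \<mu> a \<le> 1"
  shows "AE \<omega> in M. filterlim (\<lambda>t. pulls a (H t \<omega>)) at_top sequentially \<longrightarrow>
     (\<lambda>t. emp_mean a (H t \<omega>)) \<longlonglongrightarrow> \<mu> a"
proof -
  define D where "D = (\<lambda>\<epsilon> n. {\<omega>\<in>space M. \<exists>t\<ge>1. pulls a (H t \<omega>) = n \<and>
      \<epsilon> * real n \<le> \<bar>real (successes a (H t \<omega>)) - \<mu> a * real n\<bar>})"
  have [measurable]: "D \<epsilon> n \<in> events" for \<epsilon> n unfolding D_def by measurable
  have "AE \<omega> in M. eventually (\<lambda>n. \<omega> \<in> space M - D \<epsilon> n) sequentially" if "\<epsilon> > 0" for \<epsilon>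
  proof (rule borel_cantelli_AE1)
    have "summable (\<lambda>n. 2 * exp (- (2 * \<epsilon>\<^sup>2)) ^ n)"
      using that by (intro summable_mult summable_geometric) simp
    then show "summable (\<lambda>n. prob (D \<epsilon> n))"
      by (rule summable_comparison_test'[where N = 0])
         (use prob_deviation_le[OF \<mu>, of \<epsilon> a] that in \<open>auto simp: D_def\<close>)
  qed (auto simp: emeasure_eq_measure)
  \<comment> \<open>A countable family of tolerances lets one null set serve all of them.\<close>
  then have "AE \<omega> in M. \<forall>m. eventually (\<lambda>n. \<omega> \<in> space M - D (inverse (real (Suc m))) n)
      sequentially"
    by (subst AE_all_countable) simp
  then show ?thesis
  proof eventually_elim
    case (elim \<omega>)
    show ?case
    proof
      assume lim: "filterlim (\<lambda>t. pulls a (H t \<omega>)) at_top sequentially"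
      show "(\<lambda>t. emp_mean a (H t \<omega>)) \<longlonglongrightarrow> \<mu> a"
      proof (rule tendstoI)
        fix e :: real assume "e > 0"
        then obtain m where m: "inverse (real (Suc m)) < e" using reals_Archimedean by blast
        \<comment> \<open>Borel-Cantelli speaks about pull counts; the divergence of the count along
          this path carries it over to times.\<close>
        have "eventually (\<lambda>t. \<omega> \<in> space M - D (inverse (real (Suc m))) (pulls a (H t \<omega>)))
            sequentially"
          using elim lim by (auto simp: filterlim_iff)
        moreover have "eventually (\<lambda>t. 1 \<le> pulls a (H t \<omega>)) sequentially"
          using lim by (simp only: filterlim_at_top)
        ultimately show "eventually (\<lambda>t. dist (emp_mean a (H t \<omega>)) (\<mu> a) < e) sequentially"
          using eventually_ge_at_top[of 1]
        proof eventually_elim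
          case (elim t)
          let ?n = "real (pulls a (H t \<omega>))"
          have "\<bar>real (successes a (H t \<omega>)) - \<mu> a * ?n\<bar> < inverse (real (Suc m)) * ?n"
            using elim unfolding D_def by (auto simp: not_le)
          moreover have "emp_mean a (H t \<omega>) - \<mu> a = (real (successes a (H t \<omega>)) - \<mu> a * ?n) / ?n"
            using elim by (simp add: emp_mean_def diff_divide_distrib)
          ultimately have "\<bar>emp_mean a (H t \<omega>) - \<mu> a\<bar> < inverse (real (Suc m))"
            using elim by (simp add: pos_divide_less_eq)
          then show ?case using m by (simp add: dist_real_def)
        qed
      qed
    qed
  qed
qed

text \<open>Peeling off the last round costs a factor of at most \<open>1 - \<delta>\<close>. The
  lower bound on the policy is part of the event because it depends on the random history.\<close>

lemma prob_never_pulled_le: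
  assumes "s \<ge> 1" "0 \<le> \<delta>" "\<delta> \<le> 1"
  shows "prob {\<omega>\<in>space M. \<forall>u\<in>{s..<s + n}. A u \<omega> \<noteq> b \<and> \<delta> \<le> pmf (\<pi> (H u \<omega>)) b} \<le> (1 - \<delta>) ^ n"
proof (induction n)
  case 0
  then show ?case by (simp add: prob_space)
next
  case (Suc n)
  define t where "t = s + n"
  have st: "s + n = t" "s + Suc n = Suc t" "s \<le> t" by (simp_all add: t_def)
  have t: "t \<ge> 1" using assms by (simp add: t_def)
  note [measurable] = measurable_arm[OF t]
  \<comment> \<open>\<open>Q\<close> encodes the rounds before \<open>t\<close>; \<open>P\<close>
    adds the condition on the policy at \<open>t\<close>, known before the arm is drawn. The event
    for one more round is \<open>P\<close> minus its part on which \<open>b\<close> is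
    pulled.\<close>
  define Q where "Q = (\<lambda>h. of_bool (\<forall>u\<in>{s..<t}. fst (h ! (u - 1)) \<noteq> b \<and> \<delta>
      \<le> pmf (\<pi> (take (u - 1) h)) b) :: real)"
  define P where "P = (\<lambda>h. Q h * of_bool (\<delta> \<le> pmf (\<pi> h) b))"
  have Q: "Q (H t \<omega>) = of_bool (\<forall>u\<in>{s..<t}. A u \<omega> \<noteq> b \<and> \<delta> \<le> pmf (\<pi> (H u \<omega>)) b)" for \<omega>
    unfolding Q_def using \<open>s \<ge> 1\<close>
    by (intro arg_cong[where f = of_bool] ball_cong)
       (auto simp: take_history_before[simplified] nth_history_before[simplified])
  have meas: "{\<omega>\<in>space M. \<forall>u\<in>{s..<s + n}. A u \<omega> \<noteq> b \<and> \<delta> \<le> pmf (\<pi> (H u \<omega>)) b} \<in> events" for n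
  proof -
    have "{\<omega>\<in>space M. A u \<omega> \<noteq> b \<and> \<delta> \<le> pmf (\<pi> (H u \<omega>)) b} \<in> events" if "u \<ge> s" for u
    proof -
      have [measurable]: "A u \<in> measurable M (count_space UNIV)"
        using that \<open>s \<ge> 1\<close> by (intro measurable_arm) simp
      show ?thesis by measurable
    qed
    then show ?thesis by (intro sets.sets_Collect_finite_All) auto
  qed
  have int: "integrable M (\<lambda>\<omega>. P (H t \<omega>))" "integrable M (\<lambda>\<omega>. P (H t \<omega>) * pmf (\<pi> (H t \<omega>)) b)"
    "integrable M (\<lambda>\<omega>. (1 - \<delta>) * Q (H t \<omega>))" "integrable M (\<lambda>\<omega>. P (H t \<omega>) * (1 - pmf (\<pi> (H t \<omega>))
        b))"
    by (rule integrable_history)+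
  have int': "integrable M (\<lambda>\<omega>. P (H t \<omega>) * indicator {\<omega>\<in>space M. A t \<omega> = b} \<omega>)"
    by (rule integrable_history_indicator) measurable
  have "prob {\<omega>\<in>space M. \<forall>u\<in>{s..<s + Suc n}. A u \<omega> \<noteq> b \<and> \<delta> \<le> pmf (\<pi> (H u \<omega>)) b} =
    expectation (indicator {\<omega>\<in>space M. \<forall>u\<in>{s..<s + Suc n}. A u \<omega> \<noteq> b \<and> \<delta> \<le> pmf (\<pi> (H u \<omega>)) b})"
    using meas[of "Suc n"] by simp
  also have "\<dots> = expectation (\<lambda>\<omega>. P (H t \<omega>) - P (H t \<omega>) * indicator {\<omega>\<in>space M. A t \<omega> = b} \<omega>)"
    by (intro Bochner_Integration.integral_cong refl)
       (use \<open>s \<le> t\<close> in \<open>auto simp: P_def Q st indicator_def less_Suc_eq\<close>)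
  also have "\<dots> = expectation (\<lambda>\<omega>. P (H t \<omega>)) - expectation (\<lambda>\<omega>. P (H t \<omega>) * pmf (\<pi> (H t \<omega>)) b)"
    using int int' by (simp add: expectation_arm[OF t])
  also have "\<dots> = expectation (\<lambda>\<omega>. P (H t \<omega>) * (1 - pmf (\<pi> (H t \<omega>)) b))"
    using int by (simp add: right_diff_distrib)
  also have "\<dots> \<le> expectation (\<lambda>\<omega>. (1 - \<delta>) * Q (H t \<omega>))"
    using int assms by (intro integral_mono) (auto simp: P_def Q_def)
  also have "\<dots> = (1 - \<delta>) * expectation (\<lambda>\<omega>. Q (H t \<omega>))"
    by simp
  also have "expectation (\<lambda>\<omega>. Q (H t \<omega>)) =
    expectation (indicator {\<omega>\<in>space M. \<forall>u\<in>{s..<s + n}. A u \<omega> \<noteq> b \<and> \<delta> \<le> pmf (\<pi> (H u \<omega>)) b})"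
    by (intro Bochner_Integration.integral_cong refl) (auto simp: Q st indicator_def)
  also have "\<dots> = prob {\<omega>\<in>space M. \<forall>u\<in>{s..<s + n}. A u \<omega> \<noteq> b \<and> \<delta> \<le> pmf (\<pi> (H u \<omega>)) b}"
    using meas[of n] by simp
  also have "(1 - \<delta>) * \<dots> \<le> (1 - \<delta>) * (1 - \<delta>) ^ n"
    using assms by (intro mult_left_mono Suc.IH) auto
  finally show ?case by simp
qed

text \<open>The complement has probability at most \<open>(1 - \<delta>) ^ n\<close> for every
  \<open>n\<close>. Taken for all starting times, this excludes that \<open>b\<close> is abandoned
  while its conditional probability stays at least \<open>\<delta>\<close>.\<close>

lemma AE_pulled_or_improbable:
  assumes "s \<ge> 1" "0 < \<delta>" "\<delta> \<le> 1"
  shows "AE \<omega> in M. \<exists>u\<ge>s. A u \<omega> = b \<or> pmf (\<pi> (H u \<omega>)) b < \<delta>"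
proof -
  let ?B = "\<lambda>n. {\<omega>\<in>space M. \<forall>u\<in>{s..<s + n}. A u \<omega> \<noteq> b \<and> \<delta> \<le> pmf (\<pi> (H u \<omega>)) b}"
  let ?N = "{\<omega>\<in>space M. \<forall>u\<in>{s..}. A u \<omega> \<noteq> b \<and> \<delta> \<le> pmf (\<pi> (H u \<omega>)) b}"
  have *: "{\<omega>\<in>space M. A u \<omega> \<noteq> b \<and> \<delta> \<le> pmf (\<pi> (H u \<omega>)) b} \<in> events" if "u \<ge> s" for u
  proof -
    have [measurable]: "A u \<in> measurable M (count_space UNIV)"
      using that \<open>s \<ge> 1\<close> by (intro measurable_arm) simp
    show ?thesis by measurable
  qed
  have N: "?N \<in> events" "?B n \<in> events" for n
  proof -
    show "?N \<in> events"
      by (rule sets.sets_Collect_countable_All'; (rule *)?; simp)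
    show "?B n \<in> events"
      by (rule sets.sets_Collect_countable_All'; (rule *)?; simp)
  qed
  have "prob ?N \<le> (1 - \<delta>) ^ n" for n
  proof -
    have "prob ?N \<le> prob (?B n)" using N by (intro finite_measure_mono) auto
    also have "\<dots> \<le> (1 - \<delta>) ^ n" using assms by (intro prob_never_pulled_le) auto
    finally show ?thesis .
  qed
  moreover have "(\<lambda>n. (1 - \<delta>) ^ n) \<longlonglongrightarrow> 0"
    using assms by (intro LIMSEQ_realpow_zero) auto
  ultimately have "prob ?N \<le> 0"
    by (intro LIMSEQ_le_const) auto
  then have "emeasure M ?N = 0"
    by (simp only: emeasure_eq_measure measure_le_0_iff ennreal_0)
  then have "AE \<omega> in M. \<omega> \<notin> ?N"
    using N(1) by (intro AE_not_in null_setsI)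
  then show ?thesis
    using AE_space
  proof eventually_elim
    case (elim \<omega>)
    then have "\<not> (\<forall>u\<in>{s..}. A u \<omega> \<noteq> b \<and> \<delta> \<le> pmf (\<pi> (H u \<omega>)) b)" by blast
    then show ?case by (meson atLeast_iff not_le)
  qed
qed

end

subsection \<open>Exploration episodes\<close>

text \<open>A finite infimum in \<open>enat\<close> is attained, so finite episode starts can be
  treated by first-order statements about times.\<close>

lemma Inf_enat_image_eq:
  "Inf (enat ` S) = enat s \<longleftrightarrow> s \<in> S \<and> (\<forall>t\<in>S. s \<le> t)"
proof
  assume eq: "Inf (enat ` S) = enat s"
  then have "S \<noteq> {}" by (auto simp: top_enat_def)
  then obtain x where "x \<in> enat ` S" by blast
  then have "(LEAST x. x \<in> enat ` S) \<in> enat ` S" by (rule LeastI)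
  then have "Inf (enat ` S) \<in> enat ` S" using \<open>S \<noteq> {}\<close> by (simp add: Inf_enat_def)
  moreover have "Inf (enat ` S) \<le> enat t" if "t \<in> S" for t
    using that by (intro Inf_lower) auto
  ultimately show "s \<in> S \<and> (\<forall>t\<in>S. s \<le> t)" unfolding eq by auto
next
  assume "s \<in> S \<and> (\<forall>t\<in>S. s \<le> t)"
  then show "Inf (enat ` S) = enat s"
    by (intro antisym Inf_lower Inf_greatest) auto
qed

lemma episode_start_0_iff:
  "episode_start \<alpha> 0 = enat s \<longleftrightarrow>
     1 \<le> s \<and> \<alpha> s = Arm2 \<and> (\<forall>t. 1 \<le> t \<and> t < s \<longrightarrow> \<alpha> t \<noteq> Arm2)"
  unfolding episode_start.simps Inf_enat_image_eq mem_Collect_eq Ball_def by (meson not_le)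

lemma episode_start_Suc_iff:
  "episode_start \<alpha> (Suc k) = enat s \<longleftrightarrow> (\<exists>u<s. episode_start \<alpha> k = enat u \<and>
     \<alpha> s = Arm2 \<and> \<alpha> (s - 1) = Arm1 \<and> (\<forall>t. u < t \<and> t < s \<longrightarrow> \<not> (\<alpha> t = Arm2 \<and> \<alpha> (t - 1) = Arm1)))"
proof (cases "episode_start \<alpha> k")
  case (enat u)
  have "episode_start \<alpha> (Suc k) = enat s \<longleftrightarrow> u < s \<and> \<alpha> s = Arm2 \<and> \<alpha> (s - 1) = Arm1 \<and>
      (\<forall>t. u < t \<and> t < s \<longrightarrow> \<not> (\<alpha> t = Arm2 \<and> \<alpha> (t - 1) = Arm1))"
    unfolding episode_start.simps Inf_enat_image_eq mem_Collect_eq Ball_def enat enat_ord_simps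
    by (meson not_le)
  then show ?thesis by (simp only: enat enat.inject) blast
next
  case infinity
  then show ?thesis by (simp add: top_enat_def)
qed

declare episode_start.simps [simp del]

text \<open>Starts increase strictly and the first is at least 1. This later turns limits in time
  into limits in \<open>k\<close>, and it keeps time 0 out of the arguments.\<close>

lemma episode_start_gt: "episode_start \<alpha> k = enat s \<Longrightarrow> k < s"
proof (induction k arbitrary: s)
  case 0
  then show ?case by (simp add: episode_start_0_iff)
next
  case (Suc k)
  then obtain u where "u < s" "episode_start \<alpha> k = enat u" by (auto simp: episode_start_Suc_iff)
  with Suc.IH[of u] show ?case by simp
qed

lemma episode_start_Arm2: "episode_start \<alpha> k = enat s \<Longrightarrow> \<alpha> s = Arm2"
  by (cases k) (auto simp: episode_start_0_iff episode_start_Suc_iff)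

text \<open>This is the stopping time property; with \<open>\<beta>\<close> read off a history, it
  makes a start at \<open>s\<close> a predicate of that history.\<close>

lemma episode_start_cong:
  assumes "\<And>t. 1 \<le> t \<Longrightarrow> t \<le> s \<Longrightarrow> \<alpha> t = \<beta> t"
  shows "episode_start \<alpha> k = enat s \<longleftrightarrow> episode_start \<beta> k = enat s"
  using assms
proof (induction k arbitrary: s)
  case 0
  then show ?case by (auto simp: episode_start_0_iff)
next
  case (Suc k)
  have IH: "episode_start \<alpha> k = enat u \<longleftrightarrow> episode_start \<beta> k = enat u" if "u < s" for u
    using that Suc.prems by (intro Suc.IH) auto
  \<comment> \<open>Here \<open>u > 0\<close> by \<open>episode_start_gt\<close>, so
    \<open>t - 1\<close> is at least 1 and lies in the range where the paths agree.\<close>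
  have eq: "\<alpha> t = \<beta> t \<and> \<alpha> (t - 1) = \<beta> (t - 1)" if "u < t" "t \<le> s" "episode_start \<beta> k =
      enat u" for t u
    using that episode_start_gt[OF that(3)] Suc.prems[of t] Suc.prems[of "t - 1"] by simp
  have "(u < s \<and> episode_start \<alpha> k = enat u \<and> \<alpha> s = Arm2 \<and> \<alpha> (s - 1) = Arm1 \<and>
      (\<forall>t. u < t \<and> t < s \<longrightarrow> \<not> (\<alpha> t = Arm2 \<and> \<alpha> (t - 1) = Arm1))) \<longleftrightarrow>
    (u < s \<and> episode_start \<beta> k = enat u \<and> \<beta> s = Arm2 \<and> \<beta> (s - 1) = Arm1 \<and>
      (\<forall>t. u < t \<and> t < s \<longrightarrow> \<not> (\<beta> t = Arm2 \<and> \<beta> (t - 1) = Arm1)))" for u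
  proof (cases "u < s \<and> episode_start \<beta> k = enat u")
    case True
    then have "episode_start \<alpha> k = enat u" using IH by blast
    moreover have "\<alpha> t = \<beta> t" "\<alpha> (t - 1) = \<beta> (t - 1)" if "u < t" "t \<le> s" for t
      using eq[OF that] True by auto
    ultimately show ?thesis using True by (metis less_imp_le_nat order_refl)
  next
    case False
    then show ?thesis using IH by blast
  qed
  then show ?case unfolding episode_start_Suc_iff by (intro ex_cong1) simp
qed

lemma episode_start_finite:
  assumes "\<And>b s. \<exists>u\<ge>s. \<alpha> u = b"
  shows "\<exists>s. episode_start \<alpha> k = enat s"
proof (induction k)
  case 0
  obtain u where "u \<ge> 1" "\<alpha> u = Arm2" using assms by blast
  then have u: "1 \<le> u \<and> \<alpha> u = Arm2" by simp
  define s where "s = (LEAST u. 1 \<le> u \<and> \<alpha> u = Arm2)"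
  have "1 \<le> s \<and> \<alpha> s = Arm2" 
    using LeastI[of "\<lambda>u. 1 \<le> u \<and> \<alpha> u = Arm2", OF u] by (simp only: s_def)
  moreover have "\<not> (1 \<le> t \<and> \<alpha> t = Arm2)" if "t < s" for t
    using not_less_Least[of t "\<lambda>u. 1 \<le> u \<and> \<alpha> u = Arm2"] that unfolding s_def by blast
  ultimately have "episode_start \<alpha> 0 = enat s"
    unfolding episode_start_0_iff by blast
  then show ?case by blast
next
  case (Suc k)
  then obtain u where u: "episode_start \<alpha> k = enat u" by blast
  let ?P = "\<lambda>t. u < t \<and> \<alpha> t = Arm2 \<and> \<alpha> (t - 1) = Arm1"
  obtain v where v: "v \<ge> u" "\<alpha> v = Arm1" using assms by blast
  obtain w where w: "w \<ge> v" "\<alpha> w = Arm2" using assms by blast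
  \<comment> \<open>The first pull of the second arm from \<open>v\<close> on. Since
    \<open>v\<close> itself is a pull of the first arm, the round before \<open>x\<close> is not
    earlier than \<open>v\<close>, and by minimality it plays the first arm.\<close>
  define x where "x = (LEAST t. v \<le> t \<and> \<alpha> t = Arm2)"
  have x: "v \<le> x \<and> \<alpha> x = Arm2" 
    using LeastI[of "\<lambda>t. v \<le> t \<and> \<alpha> t = Arm2" w] w unfolding x_def by blast
  have "v \<noteq> x" using x v by auto
  then have "v \<le> x - 1" "x - 1 < x" using x by auto
  then have "\<alpha> (x - 1) \<noteq> Arm2"
    using not_less_Least[of "x - 1" "\<lambda>t. v \<le> t \<and> \<alpha> t = Arm2"] unfolding x_def by blast
  then have "?P x" using x v \<open>v \<noteq> x\<close> by (cases "\<alpha> (x - 1)") auto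
  define s where "s = (LEAST t. ?P t)"
  have "?P s" 
    using LeastI[of ?P x] \<open>?P x\<close> unfolding s_def by blast
  moreover have "\<not> ?P t" if "t < s" for t
    using not_less_Least[of t ?P] that unfolding s_def by blast
  ultimately have "episode_start \<alpha> (Suc k) = enat s"
    unfolding episode_start_Suc_iff using u by blast
  then show ?case by blast
qed

section \<open>Recurrence of both arms\<close>

context bandit_process
begin

lemma pulls_Suc: "t \<ge> 1 \<Longrightarrow> pulls b (H (Suc t) \<omega>) = pulls b (H t \<omega>) + of_bool (A t \<omega> = b)"
  by (simp add: history_before_Suc)

lemma pulls_mono: "1 \<le> s \<Longrightarrow> s \<le> t \<Longrightarrow> pulls b (H s \<omega>) \<le> pulls b (H t \<omega>)"
  by (induction t rule: nat_induct) (auto simp: pulls_Suc le_Suc_eq)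

lemma pulls_at_top:
  assumes "\<And>s. \<exists>u\<ge>s. A u \<omega> = b"
  shows "filterlim (\<lambda>t. pulls b (H t \<omega>)) at_top sequentially"
  unfolding filterlim_at_top eventually_sequentially
proof
  fix K
  have "\<exists>t\<ge>1. K \<le> pulls b (H t \<omega>)"
  proof (induction K)
    case (Suc K)
    then obtain t where t: "t \<ge> 1" "K \<le> pulls b (H t \<omega>)" by blast
    obtain u where u: "u \<ge> t" "A u \<omega> = b" using assms by blast
    then have "Suc K \<le> pulls b (H (Suc u) \<omega>)"
      using t pulls_mono[of t u b \<omega>] by (simp add: pulls_Suc)
    then show ?case by (intro exI[of _ "Suc u"]) simp
  qed auto
  then obtain t where "t \<ge> 1" "K \<le> pulls b (H t \<omega>)" by blast
  then show "\<exists>N. \<forall>t\<ge>N. K \<le> pulls b (H t \<omega>)"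
    using pulls_mono le_trans by (intro exI[of _ t]) blast
qed

lemma statistics_const:
  assumes "s \<ge> 1" "\<And>u. u \<ge> s \<Longrightarrow> A u \<omega> \<noteq> b" "t \<ge> s"
  shows "pulls b (H t \<omega>) = pulls b (H s \<omega>) \<and> successes b (H t \<omega>) = successes b (H s \<omega>)"
  using \<open>t \<ge> s\<close>
  by (induction t rule: dec_induct) (use assms in \<open>auto simp: history_before_Suc\<close>)

lemma AE_all_arms_infinitely_often:
  assumes policy: "thompson_sampling \<pi> \<or> med \<pi>"
    and \<mu>: "\<And>a. 0 < \<mu> a" "\<And>a. \<mu> a < 1"
  shows "AE \<omega> in M. \<forall>b s. \<exists>u\<ge>s. A u \<omega> = b"
proof -
  \<comment> \<open>\<open>Suc s\<close> keeps the starting time positive, and thresholds of the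
    form \<open>inverse (real (Suc m))\<close> leave only countably many null sets.\<close>
  have "AE \<omega> in M. \<forall>b s m. \<exists>u\<ge>Suc s. A u \<omega> = b \<or> pmf (\<pi> (H u \<omega>)) b < inverse (real (Suc m))"
    unfolding AE_all_countable
    by (intro allI AE_pulled_or_improbable) (auto simp: inverse_le_1_iff)
  moreover have "AE \<omega> in M. \<forall>a. filterlim (\<lambda>t. pulls a (H t \<omega>)) at_top sequentially \<longrightarrow>
     (\<lambda>t. emp_mean a (H t \<omega>)) \<longlonglongrightarrow> \<mu> a"
    unfolding AE_all_countable using \<mu> by (intro allI AE_emp_mean_tendsto less_imp_le)
  ultimately show ?thesis
  proof eventually_elim
    case (elim \<omega>)
    show ?case
    proof (rule ccontr)
      assume "\<not> ?thesis"
      then obtain b s0 where "\<And>u. u \<ge> s0 \<Longrightarrow> A u \<omega> \<noteq> b" by blast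
      then have never: "\<And>u. u \<ge> Suc s0 \<Longrightarrow> A u \<omega> \<noteq> b" by simp
      define c where "c = (if b = Arm1 then Arm2 else Arm1)"
      have "b \<noteq> c" by (auto simp: c_def)
      have "A u \<omega> = c" if "u \<ge> Suc s0" for u
        using never[OF that] \<open>b \<noteq> c\<close> by (cases "A u \<omega>"; cases b; cases c) auto
      then have pulls: "filterlim (\<lambda>t. pulls c (H t \<omega>)) at_top sequentially"
        by (intro pulls_at_top) (metis max.cobounded1 max.cobounded2)
      then have mean: "(\<lambda>t. emp_mean c (H t \<omega>)) \<longlonglongrightarrow> \<mu> c" using elim by blast
      have const: "eventually (\<lambda>t. pulls b (H t \<omega>) = pulls b (H (Suc s0) \<omega>) \<and>
          successes b (H t \<omega>) = successes b (H (Suc s0) \<omega>)) sequentially"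
        using eventually_ge_at_top[of "Suc s0"]
        by eventually_elim (rule statistics_const, use never in auto)
      obtain \<delta> where \<delta>: "\<delta> > 0" "eventually (\<lambda>t. \<delta> \<le> pmf (\<pi> (H t \<omega>)) b) sequentially"
        using policy thompson_sampling_explores[OF _ \<open>b \<noteq> c\<close> pulls mean \<mu>(2) const]
          med_explores[OF _ \<open>b \<noteq> c\<close> pulls mean \<mu>(2) const] by auto
      then obtain N where N: "\<And>t. t \<ge> N \<Longrightarrow> \<delta> \<le> pmf (\<pi> (H t \<omega>)) b"
        by (auto simp: eventually_sequentially)
      obtain m where m: "inverse (real (Suc m)) < \<delta>" using reals_Archimedean \<delta>(1) by blast
      \<comment> \<open>Beyond both \<open>s0\<close> and \<open>N\<close> each alternative fails:
        \<open>b\<close> is no longer pulled, and its probability is at least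
        \<open>\<delta>\<close>.\<close>
      obtain u where u: "u \<ge> Suc (max s0 N)"
        "A u \<omega> = b \<or> pmf (\<pi> (H u \<omega>)) b < inverse (real (Suc m))"
        using elim by blast
      then have "u \<ge> Suc s0" "u \<ge> N" by auto
      then show False using u(2) never[of u] N[of u] m by auto
    qed
  qed
qed

lemma AE_pmf_Arm2_tendsto_0:
  assumes policy: "thompson_sampling \<pi> \<or> med \<pi>"
    and \<mu>: "0 < \<mu> Arm2" "\<mu> Arm2 < \<mu> Arm1" "\<mu> Arm1 < 1"
  shows "AE \<omega> in M. (\<lambda>t. pmf (\<pi> (H t \<omega>)) Arm2) \<longlonglongrightarrow> 0"
proof -
  have \<mu>': "0 < \<mu> a" "\<mu> a < 1" for a using \<mu> by (cases a; simp)+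
  have "AE \<omega> in M. \<forall>a. filterlim (\<lambda>t. pulls a (H t \<omega>)) at_top sequentially \<longrightarrow>
     (\<lambda>t. emp_mean a (H t \<omega>)) \<longlonglongrightarrow> \<mu> a"
    unfolding AE_all_countable using \<mu>' by (intro allI AE_emp_mean_tendsto less_imp_le)
  then show ?thesis
    using AE_all_arms_infinitely_often[OF policy \<mu>']
  proof eventually_elim
    case (elim \<omega>)
    then have pulls: "filterlim (\<lambda>t. pulls a (H t \<omega>)) at_top sequentially" for a
      by (intro pulls_at_top) auto
    then have mean: "(\<lambda>t. emp_mean a (H t \<omega>)) \<longlonglongrightarrow> \<mu> a" for a using elim by blast
    show ?case
      using policy thompson_sampling_tendsto_0[OF _ pulls mean \<mu>(2)] med_tendsto_0[OF _ pulls
          mean \<mu>] by blast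
  qed
qed

section \<open>Arms drawn after the start of an episode\<close>

definition episode_event :: "nat \<Rightarrow> nat \<Rightarrow> 'w set" where
  "episode_event k s = {\<omega>\<in>space M. episode_start (\<lambda>t. A t \<omega>) k = enat s}"

lemma episode_event_history:
  assumes "s < t"
  shows "episode_start (\<lambda>u. A u \<omega>) k = enat s \<longleftrightarrow> episode_start (\<lambda>u. fst (H t \<omega> ! (u - 1))) k =
      enat s"
  using assms by (intro episode_start_cong) (simp add: nth_history_before[simplified])

lemma episode_event_measurable [measurable]: "episode_event k s \<in> events"
  unfolding episode_event_def episode_event_history[OF lessI] by measurable

definition episode_Arm2 :: "nat \<Rightarrow> nat \<Rightarrow> nat \<Rightarrow> 'w set" where
  "episode_Arm2 i k s = {\<omega>\<in>space M. \<omega> \<in> episode_event k s \<and> A (s + i) \<omega> = Arm2}"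

lemma episode_Arm2_measurable [measurable]: "episode_Arm2 i k s \<in> events"
proof (cases "s = 0")
  \<comment> \<open>Measurability of \<open>A\<close> is assumed only from time 1 on; at
    \<open>s = 0\<close> the event is empty because episodes start later.\<close>
  case True
  then have "episode_Arm2 i k s = {}"
    using episode_start_gt by (fastforce simp: episode_Arm2_def episode_event_def)
  then show ?thesis by simp
next
  case False
  then have [measurable]: "A (s + i) \<in> measurable M (count_space UNIV)"
    by (intro measurable_arm) simp
  show ?thesis unfolding episode_Arm2_def by measurable
qed

text \<open>For \<open>i \<ge> 1\<close> the history \<open>H (s + i)\<close> contains the arm of
  round \<open>s\<close>, so a start at \<open>s\<close> is known before the arm of round
  \<open>s + i\<close> is drawn and \<open>expectation_arm\<close> applies.\<close>

lemma emeasure_episode_Arm2_start: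
  assumes "i \<ge> 1"
  shows "emeasure M (episode_Arm2 i k s) =
    (\<integral>\<^sup>+\<omega>. ennreal (indicator (episode_event k s) \<omega> * pmf (\<pi> (H (s + i) \<omega>)) Arm2) \<partial>M)"
proof -
  define f where "f = (\<lambda>h :: history. of_bool (episode_start (\<lambda>u. fst (h ! (u - 1))) k =
      enat s) :: real)"
  have f: "f (H (s + i) \<omega>) = indicator (episode_event k s) \<omega>" if "\<omega> \<in> space M" for \<omega>
    using that assms episode_event_history[of s "s + i" \<omega> k]
    by (auto simp: f_def episode_event_def indicator_def)
  have "prob (episode_Arm2 i k s) = expectation (indicator (episode_Arm2 i k s))"
    by simp
  also have "\<dots> = expectation (\<lambda>\<omega>. f (H (s + i) \<omega>) * indicator {\<omega>\<in>space M. A (s + i) \<omega> = Arm2} \<omega>)"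
    by (intro Bochner_Integration.integral_cong refl) (auto simp: f episode_Arm2_def indicator_def)
  also have "\<dots> = expectation (\<lambda>\<omega>. f (H (s + i) \<omega>) * pmf (\<pi> (H (s + i) \<omega>)) Arm2)"
    using assms by (intro expectation_arm) simp
  finally have "ennreal (prob (episode_Arm2 i k s)) =
      ennreal (expectation (\<lambda>\<omega>. f (H (s + i) \<omega>) * pmf (\<pi> (H (s + i) \<omega>)) Arm2))" by simp
  also have "\<dots> = (\<integral>\<^sup>+\<omega>. ennreal (f (H (s + i) \<omega>) * pmf (\<pi> (H (s + i) \<omega>)) Arm2) \<partial>M)"
    by (intro nn_integral_eq_integral[symmetric] integrable_history[where f =
        "\<lambda>h. f h * pmf (\<pi> h) Arm2"])
       (auto simp: f_def)
  also have "\<dots> = (\<integral>\<^sup>+\<omega>. ennreal (indicator (episode_event k s) \<omega> * pmf (\<pi> (H (s + i) \<omega>)) Arm2) \<partial>M)"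
    by (intro nn_integral_cong) (simp add: f)
  finally show ?thesis by (simp add: emeasure_eq_measure)
qed

text \<open>The policy's probability of the second arm, evaluated at a random time. The default 0
  agrees with the sum over possible starts, all of whose terms vanish when there is none.\<close>

definition episode_pmf :: "nat \<Rightarrow> nat \<Rightarrow> 'w \<Rightarrow> real" where
  "episode_pmf i k \<omega> = (case episode_start (\<lambda>t. A t \<omega>) k of
     enat s \<Rightarrow> pmf (\<pi> (H (s + i) \<omega>)) Arm2 | \<infinity> \<Rightarrow> 0)"

lemma ennreal_episode_pmf:
  assumes "\<omega> \<in> space M"
  shows "ennreal (episode_pmf i k \<omega>) =
     (\<Sum>s. ennreal (indicator (episode_event k s) \<omega> * pmf (\<pi> (H (s + i) \<omega>)) Arm2))"
proof (cases "episode_start (\<lambda>t. A t \<omega>) k")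
  case (enat s)
  have "(\<Sum>s. ennreal (indicator (episode_event k s) \<omega> * pmf (\<pi> (H (s + i) \<omega>)) Arm2)) =
    (\<Sum>s'\<in>{s}. ennreal (indicator (episode_event k s') \<omega> * pmf (\<pi> (H (s' + i) \<omega>)) Arm2))"
    using enat by (intro suminf_finite) (auto simp: episode_event_def)
  then show ?thesis
    using enat assms by (simp add: episode_pmf_def episode_event_def)
next
  case infinity
  then show ?thesis by (simp add: episode_pmf_def episode_event_def)
qed

lemma episode_pmf_measurable: "(\<lambda>\<omega>. ennreal (episode_pmf i k \<omega>)) \<in> borel_measurable M"
  by (subst measurable_cong[OF ennreal_episode_pmf]) measurable

lemma episode_pmf_bounds: "0 \<le> episode_pmf i k \<omega>" "episode_pmf i k \<omega> \<le> 1"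
  by (auto simp: episode_pmf_def pmf_le_1 split: enat.split)

lemma disjoint_episode_Arm2: "disjoint_family (episode_Arm2 i k)"
  by (auto simp: disjoint_family_on_def episode_Arm2_def episode_event_def)

text \<open>Splitting by the value of the start replaces conditioning at a stopping time;
  nonnegativity allows exchanging the sum and the integral.\<close>

lemma emeasure_episode_Arm2:
  assumes "i \<ge> 1"
  shows "emeasure M (\<Union>s. episode_Arm2 i k s) = (\<integral>\<^sup>+\<omega>. ennreal (episode_pmf i k \<omega>) \<partial>M)"
proof -
  have "emeasure M (\<Union>s. episode_Arm2 i k s) = (\<Sum>s. emeasure M (episode_Arm2 i k s))"
    by (rule suminf_emeasure[symmetric]) (auto simp: disjoint_episode_Arm2)
  also have "\<dots> = (\<Sum>s. \<integral>\<^sup>+\<omega>. ennreal (indicator (episode_event k s) \<omega> * pmf (\<pi> (H (s + i) \<omega>))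
      Arm2) \<partial>M)"
    using assms by (simp add: emeasure_episode_Arm2_start)
  also have "\<dots> = (\<integral>\<^sup>+\<omega>. (\<Sum>s. ennreal (indicator (episode_event k s) \<omega> * pmf (\<pi> (H (s + i) \<omega>))
      Arm2)) \<partial>M)"
    by (rule nn_integral_suminf[symmetric]) measurable
  also have "\<dots> = (\<integral>\<^sup>+\<omega>. ennreal (episode_pmf i k \<omega>) \<partial>M)"
    by (intro nn_integral_cong ennreal_episode_pmf[symmetric])
  finally show ?thesis .
qed

lemma prob_episode_Arm2_tendsto:
  assumes policy: "thompson_sampling \<pi> \<or> med \<pi>"
    and \<mu>: "0 < \<mu> Arm2" "\<mu> Arm2 < \<mu> Arm1" "\<mu> Arm1 < 1"
    and "i \<ge> 1"
  shows "(\<lambda>k. prob (\<Union>s. episode_Arm2 i k s)) \<longlonglongrightarrow> 0"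
proof -
  have meas: "episode_pmf i k \<in> borel_measurable M" for k
  proof -
    note [measurable] = episode_pmf_measurable[of i k]
    \<comment> \<open>Measurability is available for the \<open>ennreal\<close> version;
      nonnegativity makes the conversion back lossless.\<close>
    have "(\<lambda>\<omega>. enn2real (ennreal (episode_pmf i k \<omega>))) \<in> borel_measurable M" by measurable
    then show ?thesis by (simp add: episode_pmf_bounds)
  qed
  have int: "integrable M (episode_pmf i k)" for k
    using episode_pmf_bounds by (intro integrable_const_bound[where B = 1] meas) auto
  have "AE \<omega> in M. (\<lambda>k. episode_pmf i k \<omega>) \<longlonglongrightarrow> 0"
    using AE_pmf_Arm2_tendsto_0[OF policy \<mu>]
  proof eventually_elim
    case (elim \<omega>)
    show ?case
    proof (rule LIMSEQ_I)
      fix e :: real assume "e > 0"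
      then obtain N where N: "\<And>t. t \<ge> N \<Longrightarrow> pmf (\<pi> (H t \<omega>)) Arm2 < e"
        using LIMSEQ_D[OF elim \<open>e > 0\<close>] by auto
      \<comment> \<open>The start lies beyond \<open>k\<close>, so the observed round lies beyond
        \<open>N\<close>; without a start the value is 0.\<close>
      have "norm (episode_pmf i k \<omega> - 0) < e" if "k \<ge> N" for k
        using that \<open>e > 0\<close> episode_start_gt[of "\<lambda>t. A t \<omega>" k]
        by (auto simp: episode_pmf_def split: enat.split intro!: N)
      then show "\<exists>N. \<forall>k\<ge>N. norm (episode_pmf i k \<omega> - 0) < e" by blast
    qed
  qed
  then have "(\<lambda>k. expectation (episode_pmf i k)) \<longlonglongrightarrow> expectation (\<lambda>_. 0)"
    using episode_pmf_bounds meas by (intro integral_dominated_convergence[where w = "\<lambda>_. 1"]) auto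
  moreover have "prob (\<Union>s. episode_Arm2 i k s) = expectation (episode_pmf i k)" for k
  proof -
    have "ennreal (prob (\<Union>s. episode_Arm2 i k s)) = ennreal (expectation (episode_pmf i k))"
      using emeasure_episode_Arm2[OF \<open>i \<ge> 1\<close>, of k] nn_integral_eq_integral[OF int]
          episode_pmf_bounds
      by (simp add: emeasure_eq_measure)
    then show ?thesis using episode_pmf_bounds by (simp add: integral_nonneg_AE)
  qed
  ultimately show ?thesis by simp
qed

text \<open>Only rounds of the second arm cost anything, namely the gap. The regret 0 of a missing
  episode matches a path that lies in none of the events.\<close>

lemma episode_regret_eq:
  assumes "\<omega> \<in> space M"
  shows "episode_regret \<mu> (\<lambda>t. A t \<omega>) k T =
    (\<Sum>i<T. (\<mu> Arm1 - \<mu> Arm2) * indicator (\<Union>s. episode_Arm2 i k s) \<omega>)"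
proof (cases "episode_start (\<lambda>t. A t \<omega>) k")
  case (enat s)
  have "\<mu> Arm1 - \<mu> (A (s + i) \<omega>) = (\<mu> Arm1 - \<mu> Arm2) * indicator (\<Union>s. episode_Arm2 i k s) \<omega>" for i
    using assms enat by (cases "A (s + i) \<omega>") (auto simp: indicator_def episode_Arm2_def
        episode_event_def)
  then show ?thesis using enat by (simp add: episode_regret_def regret_def)
next
  case infinity
  then show ?thesis by (simp add: episode_regret_def episode_Arm2_def episode_event_def)
qed

lemma expectation_episode_regret:
  "expectation (\<lambda>\<omega>. episode_regret \<mu> (\<lambda>t. A t \<omega>) k T) =
    (\<Sum>i<T. (\<mu> Arm1 - \<mu> Arm2) * prob (\<Union>s. episode_Arm2 i k s))"
proof -
  have [measurable]: "(\<Union>s. episode_Arm2 i k s) \<in> events" for i by measurable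
  have "expectation (\<lambda>\<omega>. episode_regret \<mu> (\<lambda>t. A t \<omega>) k T) =
    expectation (\<lambda>\<omega>. \<Sum>i<T. (\<mu> Arm1 - \<mu> Arm2) * indicator (\<Union>s. episode_Arm2 i k s) \<omega>)"
    by (intro Bochner_Integration.integral_cong episode_regret_eq refl)
  also have "\<dots> = (\<Sum>i<T. expectation (\<lambda>\<omega>. (\<mu> Arm1 - \<mu> Arm2) * indicator (\<Union>s. episode_Arm2 i k s) \<omega>))"
    by (intro Bochner_Integration.integral_sum integrable_mult_right integrable_real_indicator)
       (auto simp: emeasure_eq_measure)
  also have "\<dots> = (\<Sum>i<T. (\<mu> Arm1 - \<mu> Arm2) * prob (\<Union>s. episode_Arm2 i k s))"
    by (intro sum.cong) auto
  finally show ?thesis .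
qed

text \<open>An episode opens with a pull of the second arm by definition, and recurrence of both
  arms makes every episode start almost surely.\<close>

lemma prob_episode_Arm2_0:
  assumes policy: "thompson_sampling \<pi> \<or> med \<pi>"
    and \<mu>: "\<And>a. 0 < \<mu> a" "\<And>a. \<mu> a < 1"
  shows "prob (\<Union>s. episode_Arm2 0 k s) = 1"
proof -
  have "AE \<omega> in M. \<omega> \<in> (\<Union>s. episode_Arm2 0 k s)"
    using AE_all_arms_infinitely_often[OF policy \<mu>] AE_space
  proof eventually_elim
    case (elim \<omega>)
    then obtain s where "episode_start (\<lambda>t. A t \<omega>) k = enat s"
      using episode_start_finite[of "\<lambda>t. A t \<omega>" k] by auto
    then show ?case
      using elim episode_start_Arm2[of "\<lambda>t. A t \<omega>" k s]
          by (auto simp: episode_Arm2_def episode_event_def)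
  qed
  then show ?thesis by (subst prob_eq_1) auto
qed

lemma RegExp_eq:
  assumes policy: "thompson_sampling \<pi> \<or> med \<pi>"
    and \<mu>: "0 < \<mu> Arm2" "\<mu> Arm2 < \<mu> Arm1" "\<mu> Arm1 < 1"
    and "T \<ge> 1"
  shows "RegExp M \<mu> A T = ereal (\<mu> Arm1 - \<mu> Arm2)"
proof -
  have \<mu>': "0 < \<mu> a" "\<mu> a < 1" for a using \<mu> by (cases a; simp)+
  \<comment> \<open>Offset 0 contributes the whole gap and every later offset vanishes in the limit;
    \<open>T \<ge> 1\<close> keeps offset 0 in the sum.\<close>
  have "(\<lambda>k. prob (\<Union>s. episode_Arm2 i k s)) \<longlonglongrightarrow> of_bool (i = 0)" for i
    using prob_episode_Arm2_0[OF policy \<mu>'] prob_episode_Arm2_tendsto[OF policy \<mu>, of i]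
    by (cases "i = 0") auto
  then have "(\<lambda>k. \<Sum>i<T. (\<mu> Arm1 - \<mu> Arm2) * prob (\<Union>s. episode_Arm2 i k s))
      \<longlonglongrightarrow> (\<Sum>i<T. (\<mu> Arm1 - \<mu> Arm2) * of_bool (i = 0))"
    by (intro tendsto_intros)
  also have "(\<Sum>i<T. (\<mu> Arm1 - \<mu> Arm2) * of_bool (i = 0)) = \<mu> Arm1 - \<mu> Arm2"
    using \<open>T \<ge> 1\<close> by (simp add: of_bool_def if_distrib sum.delta cong: if_cong)
  finally have "(\<lambda>k. expectation (\<lambda>\<omega>. episode_regret \<mu> (\<lambda>t. A t \<omega>) k T)) \<longlonglongrightarrow> \<mu> Arm1 - \<mu> Arm2"
    by (simp add: expectation_episode_regret)
  then show ?thesis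
    unfolding RegExp_def by (intro lim_imp_Limsup) auto
qed

end

theorem corollary12:
  fixes M :: "'w measure"
    and \<mu> :: "arm \<Rightarrow> real"
    and \<pi> :: policy
    and A :: "nat \<Rightarrow> 'w \<Rightarrow> arm"
    and R :: "nat \<Rightarrow> 'w \<Rightarrow> bool"
    and T :: nat
  assumes "0 < \<mu> Arm2" and "\<mu> Arm2 < \<mu> Arm1" and "\<mu> Arm1 < 1"
    and "thompson_sampling \<pi> \<or> med \<pi>"
    and "bandit_process M \<mu> \<pi> A R"
    and "T \<ge> 1"
  shows "RegExp M \<mu> A T = ereal (\<mu> Arm1 - \<mu> Arm2)"
proof -
  interpret bandit_process M \<mu> \<pi> A R by fact
  show ?thesis by (rule RegExp_eq) fact+
qed

end
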